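(* Let $X$ and $A$ be finite sets, let $H$ be a Hilbert space and let $\phi:\mathcal T_{X,A}\to\mathcal B(H)$ be a linear map. The following are equivalent: (i) $\phi$ is a unital completely positive map; (ii) $(\phi(e_{x,x',a,a'}))_{x,x',a,a'}$ is a stochastic operator matrix over $(X,A)$; (iii) there exists a unital *-representation $\pi:\mathcal C_{X,A}\to\mathcal B(H)$ such that $\phi=\pi|_{\mathcal T_{X,A}}$. Moreover, if $(E_{x,x',a,a'})_{x,x',a,a'}$ is a stochastic operator matrix over $(X,A)$ acting on a Hilbert space $H$, then there exists a unique unital completely positive map $\phi:\mathcal T_{X,A}\to\mathcal B(H)$ such that $\phi(e_{x,x',a,a'})=E_{x,x',a,a'}$ for all $x,x'\in X$, $a,a'\in A$.
   Context: Notation: $M_X=\mathcal L(\mathbb C^X)$ is the algebra of complex $X\times X$ matrices, $(e_x)_{x\in X}$ the canonical basis of $\mathbb C^X$, and $\xi\eta^*$ denotes the rank one operator $\zeta\mapsto\langle\zeta,\eta\rangle\xi$ (inner products are linear in the first variable). An operator $E\in M_X\otimes M_A\otimes\mathcal B(H)$ is written $E=(E_{x,x',a,a'})_{x,x',a,a'}$, meaning $E=\sum e_xe_{x'}^*\otimes e_ae_{a'}^*\otimes E_{x,x',a,a'}$. It is a stochastic operator matrix over $(X,A)$ acting on $H$ if $E\ge 0$ and $\mathrm{Tr}_A E=I_X\otimes I_H$, i.e. $\sum_{a}E_{x,x',a,a}=\delta_{x,x'}I_H$ for all $x,x'$. Definition of $\mathcal C_{X,A}$ and $\mathcal T_{X,A}$.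 Let $\mathcal V^0_{X,A}$ be the ternary ring (complex vector space with a ternary product $[\cdot,\cdot,\cdot]$, linear in the outer variables, conjugate linear in the middle one, with $[s,t,[u,v,w]]=[s,[v,u,t],w]=[[s,t,u],v,w]$) generated by elements $v_{a,x}$, $x\in X$, $a\in A$, subject to $\sum_{a\in A}[v_{a'',x''},v_{a,x},v_{a,x'}]=\delta_{x,x'}v_{a'',x''}$ for all $x,x',x''\in X$, $a''\in A$. A representation of these relations is a family $V=(V_{a,x})_{a,x}\subseteq\mathcal B(H_V,K_V)$ with $\sum_aV_{a,x}^*V_{a,x'}=\delta_{x,x'}I_{H_V}$; it induces a ternary representation $\theta_V$ of $\mathcal V^0_{X,A}$ (i.e. $\theta_V([u,v,w])=\theta_V(u)\theta_V(v)^*\theta_V(w)$) with $\theta_V(v_{a,x})=V_{a,x}$. Let $\mathcal V_{X,A}$ be the completion of the quotient of $\mathcal V^0_{X,A}$ by the null space of the seminorm $\|u\|=\sup_V\|\theta_V(u)\|$ over all representations $V$; it is a ternary ring of operators (TRO), faithfully represented by the direct sum of the $\theta_V$ over equivalence classes of representations. $\mathcal C_{X,A}$ is its right C*-algebra: when $\mathcal V_{X,A}$ is faithfully represented as a concrete TRO, $\mathcal C_{X,A}=\overline{\mathrm{span}}\{S^*T:S,T\in\mathcal V_{X,A}\}$; it is a unital C*-algebra. Put $e_{x,x',a,a'}=v_{a,x}^*v_{a',x'}\in\mathcal C_{X,A}$, and let $\mathcal T_{X,A}=\mathrm{span}\{e_{x,x',a,a'}:x,x'\in X,a,a'\in A\}$,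 an operator subsystem of $\mathcal C_{X,A}$; one has $\sum_ae_{x,x',a,a}=\delta_{x,x'}1$. *)

theory Defs
  imports "HOL-Analysis.Analysis" "HOL-Library.Infinite_Typeclass"
begin

section \<open>Complex Hilbert spaces\<close>

class scaleC =
  fixes scaleC :: "complex \<Rightarrow> 'a \<Rightarrow> 'a" (infixr "*\<^sub>C" 75)

class complex_vector = real_vector + scaleC +
  assumes scaleC_add_right: "a *\<^sub>C (x + y) = a *\<^sub>C x + a *\<^sub>C y"
    and scaleC_add_left: "(a + b) *\<^sub>C x = a *\<^sub>C x + b *\<^sub>C x"
    and scaleC_scaleC: "a *\<^sub>C b *\<^sub>C x = (a * b) *\<^sub>C x"
    and scaleR_scaleC: "r *\<^sub>R x = complex_of_real r *\<^sub>C x"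
begin

lemma scaleC_one: "1 *\<^sub>C x = x"
  by (metis of_real_1 scaleR_one scaleR_scaleC)

end

global_interpretation complex_vector: vector_space "scaleC :: complex \<Rightarrow> 'a \<Rightarrow> 'a::complex_vector"
  defines csubspace = complex_vector.subspace and cspan = complex_vector.span
  by standard (simp_all add: scaleC_add_right scaleC_add_left scaleC_scaleC scaleC_one)

text \<open>The inner product is linear in the first variable. Its real part is the inner product of
  the class \<^class>\<open>real_inner\<close>, so the norm and the topology are those of the library.\<close>

class complex_hilbert = complex_vector + real_inner + complete_space +
  fixes cinner :: "'a \<Rightarrow> 'a \<Rightarrow> complex"
  assumes cinner_commute: "cinner x y = cnj (cinner y x)"
    and cinner_add_left: "cinner (x + y) z = cinner x z + cinner y z"
    and cinner_scaleC_left: "cinner (c *\<^sub>C x) y = c * cinner x y"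
    and inner_eq_Re_cinner: "inner x y = Re (cinner x y)"
begin

lemma cinner_self: "cinner x x = complex_of_real ((norm x)\<^sup>2)"
proof -
  have "Im (cinner x x) = 0"
    using cinner_commute[of x x] by (simp add: complex_eq_iff)
  moreover have "Re (cinner x x) = (norm x)\<^sup>2"
    by (metis inner_eq_Re_cinner power2_norm_eq_inner)
  ultimately show ?thesis by (simp add: complex_eq_iff)
qed

lemma norm_scaleC: "norm (c *\<^sub>C x) = cmod c * norm x"
proof -
  have "cinner (c *\<^sub>C x) (c *\<^sub>C x) = c * cnj (c * cinner x x)"
    by (metis cinner_commute cinner_scaleC_left)
  also have "\<dots> = complex_of_real ((cmod c * norm x)\<^sup>2)"
    by (simp add: cinner_self complex_norm_square power_mult_distrib del: of_real_power)
  finally have "(norm (c *\<^sub>C x))\<^sup>2 = (cmod c * norm x)\<^sup>2"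
    by (simp only: cinner_self of_real_eq_iff)
  then show ?thesis by (simp add: power2_eq_iff_nonneg)
qed

end

instantiation complex :: complex_hilbert
begin
definition "scaleC c (z::complex) = c * z"
definition "cinner (z::complex) w = z * cnj w"
instance
  by standard (auto simp: scaleC_complex_def cinner_complex_def algebra_simps scaleR_conv_of_real
      inner_complex_def)
end


section \<open>Hilbert space direct sums\<close>

typedef (overloaded) ('i, 'k::complex_hilbert) hilbert_sum =
  "{f :: 'i \<Rightarrow> 'k. (\<lambda>i. (norm (f i))\<^sup>2) summable_on UNIV}"
  morphisms component Hilbert_Sum
  by (rule exI[of _ "\<lambda>_. 0"]) simp

setup_lifting type_definition_hilbert_sum

lemma component_summable: "(\<lambda>i. (norm (component f i))\<^sup>2) summable_on UNIV"
  using component[of f] by simp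

lemma hilbert_sum_eqI: "(\<And>i. component f i = component g i) \<Longrightarrow> f = g"
  by (simp add: component_inject[symmetric] fun_eq_iff)

lemma norm_add_square_le: "(norm (x + y :: 'k::real_inner))\<^sup>2 \<le> 2 * (norm x)\<^sup>2 + 2 * (norm y)\<^sup>2"
proof -
  have "(norm (x + y))\<^sup>2 \<le> (norm x + norm y)\<^sup>2"
    by (simp add: norm_triangle_ineq power_mono)
  also have "\<dots> \<le> 2 * (norm x)\<^sup>2 + 2 * (norm y)\<^sup>2"
    using sum_squares_bound[of "norm x" "norm y"] by (simp add: power2_sum)
  finally show ?thesis .
qed

lemma summable_square_add:
  fixes f g :: "'i \<Rightarrow> 'k::real_inner"
  assumes "(\<lambda>i. (norm (f i))\<^sup>2) summable_on UNIV" "(\<lambda>i. (norm (g i))\<^sup>2) summable_on UNIV"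
  shows "(\<lambda>i. (norm (f i + g i))\<^sup>2) summable_on UNIV"
proof (rule summable_on_comparison_test)
  show "(\<lambda>i. 2 * (norm (f i))\<^sup>2 + 2 * (norm (g i))\<^sup>2) summable_on UNIV"
    by (intro summable_on_add summable_on_cmult_right assms)
qed (simp_all add: norm_add_square_le)

lemma summable_square_scaleC:
  fixes f :: "'i \<Rightarrow> 'k::complex_hilbert"
  assumes "(\<lambda>i. (norm (f i))\<^sup>2) summable_on UNIV"
  shows "(\<lambda>i. (norm (c *\<^sub>C f i))\<^sup>2) summable_on UNIV"
  unfolding norm_scaleC power_mult_distrib by (intro summable_on_cmult_right assms)

instantiation hilbert_sum :: (type, complex_hilbert) complex_vector
begin

lift_definition zero_hilbert_sum :: "('a, 'b) hilbert_sum" is "\<lambda>_. 0" by simp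
lift_definition plus_hilbert_sum ::
  "('a, 'b) hilbert_sum \<Rightarrow> ('a, 'b) hilbert_sum \<Rightarrow> ('a, 'b) hilbert_sum"
  is "\<lambda>f g i. f i + g i" by (rule summable_square_add)
lift_definition uminus_hilbert_sum :: "('a, 'b) hilbert_sum \<Rightarrow> ('a, 'b) hilbert_sum"
  is "\<lambda>f i. - f i" by simp
lift_definition minus_hilbert_sum ::
  "('a, 'b) hilbert_sum \<Rightarrow> ('a, 'b) hilbert_sum \<Rightarrow> ('a, 'b) hilbert_sum"
  is "\<lambda>f g i. f i - g i"
  by (simp only: diff_conv_add_uminus) (rule summable_square_add, simp_all)
lift_definition scaleC_hilbert_sum :: "complex \<Rightarrow> ('a, 'b) hilbert_sum \<Rightarrow> ('a, 'b) hilbert_sum"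
  is "\<lambda>c f i. c *\<^sub>C f i" by (rule summable_square_scaleC)
lift_definition scaleR_hilbert_sum :: "real \<Rightarrow> ('a, 'b) hilbert_sum \<Rightarrow> ('a, 'b) hilbert_sum"
  is "\<lambda>r f i. r *\<^sub>R f i" unfolding scaleR_scaleC by (rule summable_square_scaleC)

instance
  by standard (transfer; simp add: fun_eq_iff algebra_simps scaleC_add_right scaleC_add_left
      scaleC_scaleC scaleR_scaleC[symmetric])+

end

lemmas component_simps [simp] =
  zero_hilbert_sum.rep_eq plus_hilbert_sum.rep_eq uminus_hilbert_sum.rep_eq
  minus_hilbert_sum.rep_eq scaleC_hilbert_sum.rep_eq scaleR_hilbert_sum.rep_eq

lemma cinner_zero_left [simp]: "cinner 0 (x::'k::complex_hilbert) = 0"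
  using cinner_add_left[of 0 0 x] by simp

lemma norm_cinner_le: "cmod (cinner x y) \<le> norm x * norm (y::'k::complex_hilbert)"
proof (cases "cinner x y = 0")
  case False
  define z where "z = cinner x y"
  define c where "c = cnj z / complex_of_real (cmod z)"
  have z: "z \<noteq> 0" using False by (simp add: z_def)
  have "c * z = complex_of_real (cmod z)"
    using z complex_norm_square[of z] by (simp add: c_def field_simps power2_eq_square)
  then have "cinner (c *\<^sub>C x) y = complex_of_real (cmod z)"
    by (simp add: cinner_scaleC_left z_def)
  then have "cmod z = inner (c *\<^sub>C x) y"
    by (simp add: inner_eq_Re_cinner)
  also have "\<dots> \<le> norm (c *\<^sub>C x) * norm y"
    by (rule norm_cauchy_schwarz)
  also have "norm (c *\<^sub>C x) = norm x"
    using z by (simp add: norm_scaleC c_def norm_divide)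
  finally show ?thesis by (simp add: z_def)
qed simp

lemma norm_cinner_le_squares: "cmod (cinner x y) \<le> (norm x)\<^sup>2 + (norm (y::'k::complex_hilbert))\<^sup>2"
proof -
  have "2 * (norm x * norm y) \<le> (norm x)\<^sup>2 + (norm y)\<^sup>2"
    using sum_squares_bound[of "norm x" "norm y"] by (simp add: mult.assoc)
  moreover have "0 \<le> norm x * norm y" by simp
  ultimately show ?thesis using norm_cinner_le[of x y] by linarith
qed

lemma cinner_abs_summable:
  "(\<lambda>i. norm (cinner (component f i) (component g i))) summable_on UNIV"
proof (rule summable_on_comparison_test)
  show "(\<lambda>i. (norm (component f i))\<^sup>2 + (norm (component g i))\<^sup>2) summable_on UNIV"
    by (intro summable_on_add component_summable)
qed (simp_all add: norm_cinner_le_squares)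

lemma cinner_summable: "(\<lambda>i. cinner (component f i) (component g i)) summable_on UNIV"
  by (rule abs_summable_summable[OF cinner_abs_summable])

lemma inner_summable: "(\<lambda>i. inner (component f i) (component g i)) summable_on UNIV"
  unfolding inner_eq_Re_cinner by (rule summable_on_Re[OF cinner_summable])

instantiation hilbert_sum :: (type, complex_hilbert) real_inner
begin

definition inner_hilbert_sum_def:
  "inner f g = (\<Sum>\<^sub>\<infinity>i. inner (component f i) (component g i))"
definition norm_hilbert_sum_def:
  "norm (f :: ('a, 'b) hilbert_sum) = sqrt (inner f f)"
definition dist_hilbert_sum_def:
  "dist f g = norm (f - g :: ('a, 'b) hilbert_sum)"
definition sgn_hilbert_sum_def:
  "sgn f = (f :: ('a, 'b) hilbert_sum) /\<^sub>R norm f"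
definition uniformity_hilbert_sum_def [code del]:
  "(uniformity :: (('a, 'b) hilbert_sum \<times> ('a, 'b) hilbert_sum) filter) =
     (INF e\<in>{0<..}. principal {(f, g). dist f g < e})"
definition open_hilbert_sum_def [code del]:
  "open (U :: ('a, 'b) hilbert_sum set) \<longleftrightarrow>
     (\<forall>f\<in>U. eventually (\<lambda>(f', g). f' = f \<longrightarrow> g \<in> U) uniformity)"

instance
proof
  fix f g h :: "('a, 'b) hilbert_sum" and r :: real
  show "inner f g = inner g f"
    by (simp add: inner_hilbert_sum_def inner_commute)
  show "inner (f + g) h = inner f h + inner g h"
    by (simp add: inner_hilbert_sum_def inner_add_left infsum_add inner_summable)
  show "inner (r *\<^sub>R f) g = r * inner f g"
    by (simp add: inner_hilbert_sum_def infsum_cmult_right')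
  show ge: "0 \<le> inner f f"
    by (simp add: inner_hilbert_sum_def infsum_nonneg)
  show "inner f f = 0 \<longleftrightarrow> f = 0"
  proof
    assume "inner f f = 0"
    then have "inner (component f i) (component f i) = 0" for i
      by (intro nonneg_infsum_le_0D[where A = UNIV])
        (simp_all add: inner_hilbert_sum_def inner_summable)
    then show "f = 0" by (intro hilbert_sum_eqI) simp
  qed (simp add: inner_hilbert_sum_def)
qed (simp_all add: norm_hilbert_sum_def dist_hilbert_sum_def sgn_hilbert_sum_def
    uniformity_hilbert_sum_def open_hilbert_sum_def)

end

lemma norm_hilbert_sum_square:
  "(norm f)\<^sup>2 = (\<Sum>\<^sub>\<infinity>i. (norm (component f i))\<^sup>2)"
  unfolding power2_norm_eq_inner by (rule inner_hilbert_sum_def)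

lemma norm_component_le: "norm (component f i) \<le> norm f"
proof -
  have "(\<Sum>j\<in>{i}. (norm (component f j))\<^sup>2) \<le> (norm f)\<^sup>2"
    unfolding norm_hilbert_sum_square
    by (rule finite_sum_le_infsum) (simp_all add: component_summable)
  then show ?thesis by (simp add: power2_le_iff_abs_le)
qed

instance hilbert_sum :: (type, complex_hilbert) complete_space
proof
  fix X :: "nat \<Rightarrow> ('a, 'b) hilbert_sum"
  assume X: "Cauchy X"
  have "Cauchy (\<lambda>n. component (X n) i)" for i
    unfolding Cauchy_def
  proof (intro allI impI)
    fix e :: real assume "e > 0"
    then obtain N where "dist (X m) (X n) < e" if "m \<ge> N" "n \<ge> N" for m n
      using X unfolding Cauchy_def by metis
    moreover have "dist (component (X m) i) (component (X n) i) \<le> dist (X m) (X n)" for m n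
      using norm_component_le[of "X m - X n" i] by (simp add: dist_norm)
    ultimately show "\<exists>N. \<forall>m\<ge>N. \<forall>n\<ge>N. dist (component (X m) i) (component (X n) i) < e"
      by (meson order_le_less_trans)
  qed
  then have "\<exists>l. (\<lambda>n. component (X n) i) \<longlonglongrightarrow> l" for i
    using Cauchy_convergent convergent_def by blast
  then obtain l where l: "\<And>i. (\<lambda>n. component (X n) i) \<longlonglongrightarrow> l i" by metis
  have finite_bound: "(\<Sum>i\<in>F. (norm (component (X n) i - l i))\<^sup>2) \<le> e\<^sup>2"
    if "finite F" "0 < e" and N: "\<And>m n. m \<ge> N \<Longrightarrow> n \<ge> N \<Longrightarrow> dist (X m) (X n) < e" and "n \<ge> N"
    for F n N e
  proof (rule tendsto_upperbound)
    show "(\<lambda>m. \<Sum>i\<in>F. (norm (component (X n) i - component (X m) i))\<^sup>2)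
        \<longlonglongrightarrow> (\<Sum>i\<in>F. (norm (component (X n) i - l i))\<^sup>2)"
      by (intro tendsto_intros l)
    show "\<forall>\<^sub>F m in sequentially. (\<Sum>i\<in>F. (norm (component (X n) i - component (X m) i))\<^sup>2) \<le> e\<^sup>2"
      unfolding eventually_sequentially
    proof (intro exI[of _ N] allI impI)
      fix m assume "m \<ge> N"
      have "(\<Sum>i\<in>F. (norm (component (X n - X m) i))\<^sup>2) \<le> (norm (X n - X m))\<^sup>2"
        unfolding norm_hilbert_sum_square
        by (rule finite_sum_le_infsum) (simp_all only: component_summable that, simp_all)
      also have "\<dots> \<le> e\<^sup>2"
        using N[OF \<open>n \<ge> N\<close> \<open>m \<ge> N\<close>] by (intro power_mono) (simp_all add: dist_norm)
      finally show "(\<Sum>i\<in>F. (norm (component (X n) i - component (X m) i))\<^sup>2) \<le> e\<^sup>2" by simp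
    qed
  qed simp
  have summable_diff: "(\<lambda>i. (norm (component (X n) i - l i))\<^sup>2) summable_on UNIV"
    if "0 < e" and N: "\<And>m n. m \<ge> N \<Longrightarrow> n \<ge> N \<Longrightarrow> dist (X m) (X n) < e" and "n \<ge> N" for n N e
    by (rule nonneg_bounded_partial_sums_imp_summable_on[where C = "e\<^sup>2"])
      (auto intro!: eventually_finite_subsets_at_top_weakI finite_bound that)
  obtain N where "\<And>m n. m \<ge> N \<Longrightarrow> n \<ge> N \<Longrightarrow> dist (X m) (X n) < 1"
    using X unfolding Cauchy_def by (metis zero_less_one)
  then have "(\<lambda>i. (norm (component (X N) i - l i))\<^sup>2) summable_on UNIV"
    by (intro summable_diff[of 1 N]) simp_all
  then have "(\<lambda>i. (norm (component (X N) i + - (component (X N) i - l i)))\<^sup>2) summable_on UNIV"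
    by (intro summable_square_add component_summable) (simp only: norm_minus_cancel)
  then have "(\<lambda>i. (norm (l i))\<^sup>2) summable_on UNIV" by simp
  then obtain L where L: "component L = l"
    using Hilbert_Sum_inverse by blast
  have "X \<longlonglongrightarrow> L"
    unfolding LIMSEQ_def
  proof (intro allI impI)
    fix r :: real assume "r > 0"
    define e where "e = r / 2"
    have e: "0 < e" "e < r" using \<open>r > 0\<close> by (simp_all add: e_def)
    obtain N where N: "\<And>m n. m \<ge> N \<Longrightarrow> n \<ge> N \<Longrightarrow> dist (X m) (X n) < e"
      using X e(1) unfolding Cauchy_def by metis
    have "dist (X n) L < r" if "n \<ge> N" for n
    proof -
      have "(norm (X n - L))\<^sup>2 \<le> e\<^sup>2"
        unfolding norm_hilbert_sum_square
        using summable_diff[OF e(1) N that] finite_bound[OF _ e(1) N that]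
        by (intro infsum_le_finite_sums) (simp_all add: L)
      then show ?thesis
        using e by (simp add: dist_norm power2_le_iff_abs_le)
    qed
    then show "\<exists>N. \<forall>n\<ge>N. dist (X n) L < r" by blast
  qed
  then show "convergent X" unfolding convergent_def by blast
qed

instantiation hilbert_sum :: (type, complex_hilbert) complex_hilbert
begin

definition cinner_hilbert_sum_def:
  "cinner f g = (\<Sum>\<^sub>\<infinity>i. cinner (component f i) (component g i))"

instance
proof
  fix f g h :: "('a, 'b) hilbert_sum" and c :: complex
  show "cinner f g = cnj (cinner g f)"
    unfolding cinner_hilbert_sum_def infsum_cnj[symmetric]
    by (intro infsum_cong cinner_commute)
  show "cinner (f + g) h = cinner f h + cinner g h"
    by (simp add: cinner_hilbert_sum_def cinner_add_left infsum_add cinner_summable)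
  show "cinner (c *\<^sub>C f) g = c * cinner f g"
    by (simp add: cinner_hilbert_sum_def cinner_scaleC_left infsum_cmult_right')
  show "inner f g = Re (cinner f g)"
    by (simp add: cinner_hilbert_sum_def inner_hilbert_sum_def inner_eq_Re_cinner
        infsum_Re[OF cinner_summable])
qed

end


section \<open>Bounded operators\<close>

typedef (overloaded) ('h::complex_hilbert, 'k::complex_hilbert) cblinfun
    ("(_ \<Rightarrow>\<^sub>C\<^sub>L /_)" [22, 21] 21) =
  "{T :: 'h \<Rightarrow> 'k. bounded_linear T \<and> (\<forall>c \<xi>. T (c *\<^sub>C \<xi>) = c *\<^sub>C T \<xi>)}"
  morphisms cblinfun_apply CBlinfun
  by (rule exI[of _ "\<lambda>_. 0"]) simp

notation cblinfun_apply (infixr "*\<^sub>V" 70)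

setup_lifting type_definition_cblinfun

lemma cblinfun_eqI: "(\<And>\<xi>. S *\<^sub>V \<xi> = T *\<^sub>V \<xi>) \<Longrightarrow> S = T"
  by (simp add: cblinfun_apply_inject[symmetric] fun_eq_iff)

lemma bounded_linear_scaleC: "bounded_linear (\<lambda>x. c *\<^sub>C x :: 'k::complex_hilbert)"
  by (rule bounded_linear_intro[where K = "cmod c"])
    (simp_all add: scaleC_add_right scaleR_scaleC scaleC_scaleC norm_scaleC mult.commute)

instantiation cblinfun :: (complex_hilbert, complex_hilbert) complex_vector
begin

lift_definition zero_cblinfun :: "'a \<Rightarrow>\<^sub>C\<^sub>L 'b" is "\<lambda>_. 0" by simp
lift_definition plus_cblinfun :: "('a \<Rightarrow>\<^sub>C\<^sub>L 'b) \<Rightarrow> ('a \<Rightarrow>\<^sub>C\<^sub>L 'b) \<Rightarrow> ('a \<Rightarrow>\<^sub>C\<^sub>L 'b)"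
  is "\<lambda>S T \<xi>. S \<xi> + T \<xi>" by (simp add: bounded_linear_add scaleC_add_right)
lift_definition uminus_cblinfun :: "('a \<Rightarrow>\<^sub>C\<^sub>L 'b) \<Rightarrow> ('a \<Rightarrow>\<^sub>C\<^sub>L 'b)"
  is "\<lambda>T \<xi>. - T \<xi>" by (simp add: bounded_linear_minus)
lift_definition minus_cblinfun :: "('a \<Rightarrow>\<^sub>C\<^sub>L 'b) \<Rightarrow> ('a \<Rightarrow>\<^sub>C\<^sub>L 'b) \<Rightarrow> ('a \<Rightarrow>\<^sub>C\<^sub>L 'b)"
  is "\<lambda>S T \<xi>. S \<xi> - T \<xi>"
  by (simp add: bounded_linear_sub complex_vector.scale_right_diff_distrib)
lift_definition scaleR_cblinfun :: "real \<Rightarrow> ('a \<Rightarrow>\<^sub>C\<^sub>L 'b) \<Rightarrow> ('a \<Rightarrow>\<^sub>C\<^sub>L 'b)"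
  is "\<lambda>r T \<xi>. r *\<^sub>R T \<xi>"
  by (simp add: bounded_linear_const_scaleR scaleR_scaleC scaleC_scaleC mult.commute
      bounded_linear_compose[OF bounded_linear_scaleC])
lift_definition scaleC_cblinfun :: "complex \<Rightarrow> ('a \<Rightarrow>\<^sub>C\<^sub>L 'b) \<Rightarrow> ('a \<Rightarrow>\<^sub>C\<^sub>L 'b)"
  is "\<lambda>c T \<xi>. c *\<^sub>C T \<xi>"
  by (simp add: scaleC_scaleC mult.commute bounded_linear_compose[OF bounded_linear_scaleC])

instance
  by standard (transfer; simp add: fun_eq_iff algebra_simps scaleC_add_right scaleC_add_left
      scaleC_scaleC scaleR_scaleC[symmetric])+

end

lemmas cblinfun_apply_simps [simp] =
  zero_cblinfun.rep_eq plus_cblinfun.rep_eq uminus_cblinfun.rep_eq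
  minus_cblinfun.rep_eq scaleC_cblinfun.rep_eq scaleR_cblinfun.rep_eq

instantiation cblinfun :: (complex_hilbert, complex_hilbert) real_normed_vector
begin

lift_definition norm_cblinfun :: "('a \<Rightarrow>\<^sub>C\<^sub>L 'b) \<Rightarrow> real" is onorm .
definition dist_cblinfun_def:
  "dist S T = norm (S - T :: 'a \<Rightarrow>\<^sub>C\<^sub>L 'b)"
definition sgn_cblinfun_def:
  "sgn T = (T :: 'a \<Rightarrow>\<^sub>C\<^sub>L 'b) /\<^sub>R norm T"
definition uniformity_cblinfun_def [code del]:
  "(uniformity :: (('a \<Rightarrow>\<^sub>C\<^sub>L 'b) \<times> ('a \<Rightarrow>\<^sub>C\<^sub>L 'b)) filter) =
     (INF e\<in>{0<..}. principal {(S, T). dist S T < e})"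
definition open_cblinfun_def [code del]:
  "open (U :: ('a \<Rightarrow>\<^sub>C\<^sub>L 'b) set) \<longleftrightarrow>
     (\<forall>S\<in>U. eventually (\<lambda>(S', T). S' = S \<longrightarrow> T \<in> U) uniformity)"

instance
proof
  fix S T :: "'a \<Rightarrow>\<^sub>C\<^sub>L 'b" and r :: real
  show "norm T = 0 \<longleftrightarrow> T = 0"
    by transfer (auto simp: onorm_eq_0 fun_eq_iff)
  show "norm (S + T) \<le> norm S + norm T"
    by transfer (simp add: onorm_triangle)
  show "norm (r *\<^sub>R T) = \<bar>r\<bar> * norm T"
    by transfer (simp add: onorm_scaleR)
qed (simp_all add: dist_cblinfun_def sgn_cblinfun_def uniformity_cblinfun_def open_cblinfun_def)

end

lift_definition cblinfun_compose ::
    "('k::complex_hilbert \<Rightarrow>\<^sub>C\<^sub>L 'l::complex_hilbert) \<Rightarrow> ('h::complex_hilbert \<Rightarrow>\<^sub>C\<^sub>L 'k) \<Rightarrow> ('h \<Rightarrow>\<^sub>C\<^sub>L 'l)"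
    (infixl "o\<^sub>C" 67)
  is "\<lambda>S T \<xi>. S (T \<xi>)" by (auto intro: bounded_linear_compose)

lift_definition id_op :: "'h::complex_hilbert \<Rightarrow>\<^sub>C\<^sub>L 'h" is "\<lambda>\<xi>. \<xi>" by simp

definition adj :: "('h::complex_hilbert \<Rightarrow>\<^sub>C\<^sub>L 'k::complex_hilbert) \<Rightarrow> ('k \<Rightarrow>\<^sub>C\<^sub>L 'h)" where
  "adj T = (THE S. \<forall>\<xi> \<eta>. cinner (T *\<^sub>V \<xi>) \<eta> = cinner \<xi> (S *\<^sub>V \<eta>))"

text \<open>The matrix \<open>T\<close> over the finite index set \<open>I\<close>, viewed as an operator on the direct sum of
  \<open>I\<close> copies of the Hilbert space, is positive.\<close>

definition positive_matrix :: "'i set \<Rightarrow> ('i \<Rightarrow> 'i \<Rightarrow> ('h::complex_hilbert \<Rightarrow>\<^sub>C\<^sub>L 'h)) \<Rightarrow> bool" where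
  "positive_matrix I T \<longleftrightarrow>
     (\<forall>\<xi> :: 'i \<Rightarrow> 'h. (\<Sum>i\<in>I. \<Sum>j\<in>I. cinner (T i j *\<^sub>V \<xi> j) (\<xi> i)) \<in> \<real>\<^sub>\<ge>\<^sub>0)"

definition clinear_on :: "'v::complex_vector set \<Rightarrow> ('v \<Rightarrow> 'w::complex_vector) \<Rightarrow> bool" where
  "clinear_on S \<phi> \<longleftrightarrow>
     (\<forall>s\<in>S. \<forall>t\<in>S. \<phi> (s + t) = \<phi> s + \<phi> t) \<and> (\<forall>c. \<forall>s\<in>S. \<phi> (c *\<^sub>C s) = c *\<^sub>C \<phi> s)"

definition completely_positive_on ::
    "('k::complex_hilbert \<Rightarrow>\<^sub>C\<^sub>L 'k) set \<Rightarrow> (('k \<Rightarrow>\<^sub>C\<^sub>L 'k) \<Rightarrow> ('h::complex_hilbert \<Rightarrow>\<^sub>C\<^sub>L 'h)) \<Rightarrow> bool" where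
  "completely_positive_on S \<phi> \<longleftrightarrow>
     (\<forall>n::nat. \<forall>T. (\<forall>i<n. \<forall>j<n. T i j \<in> S) \<and> positive_matrix {..<n} T \<longrightarrow>
        positive_matrix {..<n} (\<lambda>i j. \<phi> (T i j)))"

definition ucp_on ::
    "('k::complex_hilbert \<Rightarrow>\<^sub>C\<^sub>L 'k) set \<Rightarrow> (('k \<Rightarrow>\<^sub>C\<^sub>L 'k) \<Rightarrow> ('h::complex_hilbert \<Rightarrow>\<^sub>C\<^sub>L 'h)) \<Rightarrow> bool" where
  "ucp_on S \<phi> \<longleftrightarrow> clinear_on S \<phi> \<and> \<phi> id_op = id_op \<and> completely_positive_on S \<phi>"

definition unital_star_rep_on ::
    "('k::complex_hilbert \<Rightarrow>\<^sub>C\<^sub>L 'k) set \<Rightarrow> (('k \<Rightarrow>\<^sub>C\<^sub>L 'k) \<Rightarrow> ('h::complex_hilbert \<Rightarrow>\<^sub>C\<^sub>L 'h)) \<Rightarrow> bool" where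
  "unital_star_rep_on C \<pi> \<longleftrightarrow> clinear_on C \<pi> \<and>
     (\<forall>s\<in>C. \<forall>t\<in>C. \<pi> (s o\<^sub>C t) = \<pi> s o\<^sub>C \<pi> t) \<and> (\<forall>s\<in>C. \<pi> (adj s) = adj (\<pi> s)) \<and>
     \<pi> id_op = id_op"

definition stochastic_operator_matrix ::
    "('x::finite \<Rightarrow> 'x \<Rightarrow> 'a::finite \<Rightarrow> 'a \<Rightarrow> ('h::complex_hilbert \<Rightarrow>\<^sub>C\<^sub>L 'h)) \<Rightarrow> bool" where
  "stochastic_operator_matrix E \<longleftrightarrow>
     positive_matrix UNIV (\<lambda>(x, a) (x', a'). E x x' a a') \<and>
     (\<forall>x x'. (\<Sum>a\<in>UNIV. E x x' a a) = (if x = x' then id_op else 0))"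


section \<open>Ternary rings of operators\<close>

inductive_set ternary_ring_generated_by ::
    "('h::complex_hilbert \<Rightarrow>\<^sub>C\<^sub>L 'k::complex_hilbert) set \<Rightarrow> ('h \<Rightarrow>\<^sub>C\<^sub>L 'k) set"
  for G :: "('h \<Rightarrow>\<^sub>C\<^sub>L 'k) set" where
  "g \<in> G \<Longrightarrow> g \<in> ternary_ring_generated_by G"
| "s \<in> ternary_ring_generated_by G \<Longrightarrow> t \<in> ternary_ring_generated_by G \<Longrightarrow>
    s + t \<in> ternary_ring_generated_by G"
| "s \<in> ternary_ring_generated_by G \<Longrightarrow> c *\<^sub>C s \<in> ternary_ring_generated_by G"
| "s \<in> ternary_ring_generated_by G \<Longrightarrow> t \<in> ternary_ring_generated_by G \<Longrightarrow>
    u \<in> ternary_ring_generated_by G \<Longrightarrow> s o\<^sub>C adj t o\<^sub>C u \<in> ternary_ring_generated_by G"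

definition right_cstar_algebra ::
    "('h::complex_hilbert \<Rightarrow>\<^sub>C\<^sub>L 'k::complex_hilbert) set \<Rightarrow> ('h \<Rightarrow>\<^sub>C\<^sub>L 'h) set" where
  "right_cstar_algebra \<V> = closure (cspan {adj s o\<^sub>C t | s t. s \<in> \<V> \<and> t \<in> \<V>})"


section \<open>The universal TRO\<close>

text \<open>
  A representation of the relations consists of Hilbert spaces \<open>D\<close>, \<open>K\<close> and a family
  \<open>V a x : D \<rightarrow> K\<close> with \<open>\<Sum>a. (V a x)\<^sup>* (V a x') = \<delta> x x' I\<close>. To form the direct sum of all
  representations, their Hilbert spaces are taken in a universe: \<open>D\<close> ranges over the closed
  subspaces of \<open>\<ell>\<^sup>2('u)\<close>, that is, up to unitary equivalence, over all Hilbert spaces of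
  dimension at most the cardinality of \<open>'u\<close>. As \<open>K\<close> matters only as a space containing the
  ranges of the \<open>V a x\<close>, one can take \<open>K = \<ell>\<^sup>2('u)\<close>.
  Of the operators \<open>V a x\<close> only the restrictions to \<open>D\<close> are used.

  The seminorm on the free ternary ring does not depend on the infinite type \<open>'u\<close>: that ring is
  spanned by finitely many generators and their countably many ternary words, so every vector of
  \<open>D\<close> lies in a separable closed subspace which together with a separable closed subspace of \<open>K\<close>
  reduces the representation; hence separable representations already give the supremum over
  all representations.
\<close>

type_synonym 'u ell2 = "('u, complex) hilbert_sum"

typedef (overloaded) ('x::finite, 'a::finite, 'u) representation =
  "{(D :: 'u ell2 set, V :: 'a \<Rightarrow> 'x \<Rightarrow> ('u ell2 \<Rightarrow>\<^sub>C\<^sub>L 'u ell2)).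
     csubspace D \<and> closed D \<and>
     (\<forall>x x'. \<forall>\<xi>\<in>D. \<forall>\<eta>\<in>D.
        (\<Sum>a\<in>UNIV. cinner (V a x' *\<^sub>V \<xi>) (V a x *\<^sub>V \<eta>)) = (if x = x' then cinner \<xi> \<eta> else 0))}"
  by (rule exI[of _ "({0}, \<lambda>_ _. 0)"]) simp

definition rep_space :: "('x::finite, 'a::finite, 'u) representation \<Rightarrow> 'u ell2 set" where
  "rep_space R = fst (Rep_representation R)"

definition rep_op ::
    "('x::finite, 'a::finite, 'u) representation \<Rightarrow> 'a \<Rightarrow> 'x \<Rightarrow> ('u ell2 \<Rightarrow>\<^sub>C\<^sub>L 'u ell2)" where
  "rep_op R = snd (Rep_representation R)"

lemma csubspace_rep_space: "csubspace (rep_space R)"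
  and closed_rep_space: "closed (rep_space R)"
  and rep_op_relations: "\<xi> \<in> rep_space R \<Longrightarrow> \<eta> \<in> rep_space R \<Longrightarrow>
    (\<Sum>a\<in>UNIV. cinner (rep_op R a x' *\<^sub>V \<xi>) (rep_op R a x *\<^sub>V \<eta>)) =
      (if x = x' then cinner \<xi> \<eta> else 0)"
  using Rep_representation[of R] by (auto simp: rep_space_def rep_op_def split_beta)

text \<open>The direct sums of the Hilbert spaces \<open>D\<close> and \<open>K\<close> over all representations.\<close>

typedef (overloaded) ('x::finite, 'a::finite, 'u) domain_sum =
  "{f :: (('x, 'a, 'u) representation, 'u ell2) hilbert_sum. \<forall>R. component f R \<in> rep_space R}"
  morphisms family Domain_Sum
  by (rule exI[of _ 0]) (simp add: complex_vector.subspace_0[OF csubspace_rep_space])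

type_synonym ('x, 'a, 'u) codomain_sum = "(('x, 'a, 'u) representation, 'u ell2) hilbert_sum"

setup_lifting type_definition_domain_sum

instantiation domain_sum :: (finite, finite, type) complex_vector
begin

lift_definition zero_domain_sum :: "('a, 'b, 'c) domain_sum" is 0
  by (simp add: complex_vector.subspace_0[OF csubspace_rep_space])
lift_definition plus_domain_sum ::
  "('a, 'b, 'c) domain_sum \<Rightarrow> ('a, 'b, 'c) domain_sum \<Rightarrow> ('a, 'b, 'c) domain_sum" is "(+)"
  by (simp add: complex_vector.subspace_add[OF csubspace_rep_space])
lift_definition uminus_domain_sum :: "('a, 'b, 'c) domain_sum \<Rightarrow> ('a, 'b, 'c) domain_sum" is uminus
  by (simp add: complex_vector.subspace_neg[OF csubspace_rep_space])
lift_definition minus_domain_sum ::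
  "('a, 'b, 'c) domain_sum \<Rightarrow> ('a, 'b, 'c) domain_sum \<Rightarrow> ('a, 'b, 'c) domain_sum" is "(-)"
  by (simp add: complex_vector.subspace_diff[OF csubspace_rep_space])
lift_definition scaleC_domain_sum ::
  "complex \<Rightarrow> ('a, 'b, 'c) domain_sum \<Rightarrow> ('a, 'b, 'c) domain_sum" is scaleC
  by (simp add: complex_vector.subspace_scale[OF csubspace_rep_space])
lift_definition scaleR_domain_sum ::
  "real \<Rightarrow> ('a, 'b, 'c) domain_sum \<Rightarrow> ('a, 'b, 'c) domain_sum" is scaleR
  by (simp add: scaleR_scaleC complex_vector.subspace_scale[OF csubspace_rep_space])

instance
  by standard (transfer; simp add: algebra_simps scaleC_add_right scaleC_add_left
      scaleC_scaleC scaleR_scaleC[symmetric])+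

end

lemmas family_simps [simp] =
  zero_domain_sum.rep_eq plus_domain_sum.rep_eq uminus_domain_sum.rep_eq
  minus_domain_sum.rep_eq scaleC_domain_sum.rep_eq scaleR_domain_sum.rep_eq

instantiation domain_sum :: (finite, finite, type) real_inner
begin

definition inner_domain_sum_def: "inner f g = inner (family f) (family g)"
definition norm_domain_sum_def: "norm f = norm (family f)"
definition dist_domain_sum_def: "dist f g = dist (family f) (family g)"
definition sgn_domain_sum_def: "sgn f = (f :: ('a, 'b, 'c) domain_sum) /\<^sub>R norm f"
definition uniformity_domain_sum_def [code del]:
  "(uniformity :: (('a, 'b, 'c) domain_sum \<times> ('a, 'b, 'c) domain_sum) filter) =
     (INF e\<in>{0<..}. principal {(f, g). dist f g < e})"
definition open_domain_sum_def [code del]: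
  "open (U :: ('a, 'b, 'c) domain_sum set) \<longleftrightarrow>
     (\<forall>f\<in>U. eventually (\<lambda>(f', g). f' = f \<longrightarrow> g \<in> U) uniformity)"

instance
proof
  fix f g h :: "('a, 'b, 'c) domain_sum"
  show "inner f g = inner g f"
    unfolding inner_domain_sum_def by (rule inner_commute)
qed (simp_all add: inner_domain_sum_def norm_domain_sum_def dist_domain_sum_def
    sgn_domain_sum_def uniformity_domain_sum_def open_domain_sum_def dist_norm inner_add_left
    norm_eq_sqrt_inner[symmetric] family_inject[symmetric])

end

instance domain_sum :: (finite, finite, type) complete_space
proof
  fix X :: "nat \<Rightarrow> ('a, 'b, 'c) domain_sum"
  assume "Cauchy X"
  then have "Cauchy (\<lambda>n. family (X n))"
    by (simp add: Cauchy_def dist_domain_sum_def)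
  then obtain L where L: "(\<lambda>n. family (X n)) \<longlonglongrightarrow> L"
    using Cauchy_convergent convergent_def by blast
  have "component L R \<in> rep_space R" for R
  proof (rule closed_sequentially[OF closed_rep_space])
    show "component (family (X n)) R \<in> rep_space R" for n
      using family[of "X n"] by simp
    show "(\<lambda>n. component (family (X n)) R) \<longlonglongrightarrow> component L R"
    proof (rule LIMSEQ_I)
      fix r :: real assume "r > 0"
      with L obtain N where N: "\<forall>n\<ge>N. norm (family (X n) - L) < r" by (blast dest: LIMSEQ_D)
      then show "\<exists>N. \<forall>n\<ge>N. norm (component (family (X n)) R - component L R) < r"
      proof (intro exI[of _ N] allI impI)
        fix n assume "n \<ge> N"
        have "norm (component (family (X n)) R - component L R) \<le> norm (family (X n) - L)"
          using norm_component_le[of "family (X n) - L" R] by simp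
        also have "\<dots> < r" using N \<open>n \<ge> N\<close> by blast
        finally show "norm (component (family (X n)) R - component L R) < r" .
      qed
    qed
  qed
  then obtain l where "family l = L"
    using Domain_Sum_inverse[of L] by blast
  with L have "X \<longlonglongrightarrow> l"
    by (auto simp: LIMSEQ_def dist_domain_sum_def)
  then show "convergent X" unfolding convergent_def by blast
qed

instantiation domain_sum :: (finite, finite, type) complex_hilbert
begin

definition cinner_domain_sum_def: "cinner f g = cinner (family f) (family g)"

instance
proof
  fix f g h :: "('a, 'b, 'c) domain_sum"
  show "cinner f g = cnj (cinner g f)"
    unfolding cinner_domain_sum_def by (rule cinner_commute)
qed (simp_all add: cinner_domain_sum_def inner_domain_sum_def cinner_add_left
    cinner_scaleC_left inner_eq_Re_cinner)

end

lemma norm_rep_op_le: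
  assumes "\<xi> \<in> rep_space R"
  shows "norm (rep_op R a x *\<^sub>V \<xi>) \<le> norm \<xi>"
proof -
  have "(\<Sum>b\<in>UNIV. complex_of_real ((norm (rep_op R b x *\<^sub>V \<xi>))\<^sup>2)) = complex_of_real ((norm \<xi>)\<^sup>2)"
    using rep_op_relations[OF assms assms, of x x] by (simp add: cinner_self)
  then have "(\<Sum>b\<in>UNIV. (norm (rep_op R b x *\<^sub>V \<xi>))\<^sup>2) = (norm \<xi>)\<^sup>2"
    unfolding of_real_sum[symmetric] of_real_eq_iff .
  moreover have "(norm (rep_op R a x *\<^sub>V \<xi>))\<^sup>2 \<le> (\<Sum>b\<in>UNIV. (norm (rep_op R b x *\<^sub>V \<xi>))\<^sup>2)"
    by (rule member_le_sum) simp_all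
  ultimately show ?thesis by (simp add: power2_le_iff_abs_le)
qed

lemma rep_op_summable:
  "(\<lambda>R. (norm (rep_op R a x *\<^sub>V component (family f) R))\<^sup>2) summable_on UNIV"
  by (rule summable_on_comparison_test[OF component_summable[of "family f"]])
    (use family[of f] in \<open>auto intro!: power_mono norm_rep_op_le\<close>)

text \<open>The images of the generators under the direct sum of all representations.\<close>

lift_definition gen_raw ::
    "'a::finite \<Rightarrow> 'x::finite \<Rightarrow> ('x, 'a, 'u) domain_sum \<Rightarrow> ('x, 'a, 'u) codomain_sum"
  is "\<lambda>a x f R. rep_op R a x *\<^sub>V component (family f) R"
  by (rule rep_op_summable)

lemma cblinfun_apply_linear:
  "T *\<^sub>V (\<xi> + \<eta>) = T *\<^sub>V \<xi> + T *\<^sub>V \<eta>" "T *\<^sub>V (c *\<^sub>C \<xi>) = c *\<^sub>C (T *\<^sub>V \<xi>)"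
  using cblinfun_apply[of T] by (auto simp: linear_simps)

lift_definition gen ::
    "'a::finite \<Rightarrow> 'x::finite \<Rightarrow> (('x, 'a, 'u) domain_sum \<Rightarrow>\<^sub>C\<^sub>L ('x, 'a, 'u) codomain_sum)"
  is gen_raw
proof (intro conjI allI)
  fix a :: 'a and x :: 'x
  let ?g = "gen_raw a x :: ('x, 'a, 'u) domain_sum \<Rightarrow> ('x, 'a, 'u) codomain_sum"
  show scaleC: "?g (c *\<^sub>C f) = c *\<^sub>C ?g f" for c f
    by (rule hilbert_sum_eqI) (simp add: gen_raw.rep_eq cblinfun_apply_linear)
  show "bounded_linear ?g"
  proof (rule bounded_linear_intro[where K = 1])
    show "?g (f + h) = ?g f + ?g h" for f h
      by (rule hilbert_sum_eqI) (simp add: gen_raw.rep_eq cblinfun_apply_linear)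
    show "?g (r *\<^sub>R f) = r *\<^sub>R ?g f" for r f
      by (simp add: scaleR_scaleC scaleC)
    show "norm (?g f) \<le> norm f * 1" for f
    proof -
      have "(norm (?g f))\<^sup>2 \<le> (norm (family f))\<^sup>2"
        unfolding norm_hilbert_sum_square[of "?g f"] norm_hilbert_sum_square[of "family f"]
        by (rule infsum_mono[OF component_summable component_summable])
          (use family[of f] in \<open>auto simp: gen_raw.rep_eq intro!: power_mono norm_rep_op_le\<close>)
      then show ?thesis by (simp add: norm_domain_sum_def power2_le_iff_abs_le)
    qed
  qed
qed

lemma component_gen: "component (gen a x *\<^sub>V f) R = rep_op R a x *\<^sub>V component (family f) R"
  by (simp add: gen.rep_eq gen_raw.rep_eq)

text \<open>
  The quotient of \<open>\<V>\<^sup>0\<close> by the null space of the universal seminorm is isometric to the image of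
  \<open>\<V>\<^sup>0\<close> under the direct sum of all representations, which is the ternary ring generated by the
  operators \<^const>\<open>gen\<close>. Its completion is the norm closure of this image.
\<close>

definition universal_TRO ::
    "(('x::finite, 'a::finite, 'u) domain_sum \<Rightarrow>\<^sub>C\<^sub>L ('x, 'a, 'u) codomain_sum) set" where
  "universal_TRO = closure (ternary_ring_generated_by {gen a x | a x. True})"

definition C_alg :: "(('x::finite, 'a::finite, 'u) domain_sum \<Rightarrow>\<^sub>C\<^sub>L ('x, 'a, 'u) domain_sum) set" where
  "C_alg = right_cstar_algebra universal_TRO"

definition e_gen ::
    "'x::finite \<Rightarrow> 'x \<Rightarrow> 'a::finite \<Rightarrow> 'a \<Rightarrow>
      (('x, 'a, 'u) domain_sum \<Rightarrow>\<^sub>C\<^sub>L ('x, 'a, 'u) domain_sum)" where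
  "e_gen x x' a a' = adj (gen a x) o\<^sub>C gen a' x'"

definition T_sys :: "(('x::finite, 'a::finite, 'u) domain_sum \<Rightarrow>\<^sub>C\<^sub>L ('x, 'a, 'u) domain_sum) set" where
  "T_sys = cspan {e_gen x x' a a' | x x' a a'. True}"

end

theory Submission
  imports Defs
begin

text \<open>
  A stochastic operator matrix \<open>E\<close> on \<open>H\<close> factors as \<open>E x x' a a' = (V a x)\<^sup>* (V a' x')\<close>. Every
  countable subset of \<open>H\<close> lies in a separable closed subspace invariant under all \<open>E x x' a a'\<close>;
  on it the factorization is carried out inside \<open>\<ell>\<^sup>2('u)\<close>, by Gram--Schmidt for the form defined by
  \<open>E\<close>, and yields a summand of the universal representation. So that subspace embeds
  isometrically into the universal space, intertwining \<open>e_gen\<close> with \<open>E\<close>. Applied to finitely many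
  vectors, this shows that a linear map with values \<open>E\<close> is completely positive; applied to single
  vectors, it shows that \<open>e_gen \<mapsto> E\<close> is contractive on the algebra generated by the \<open>e_gen\<close>, hence
  extends to \<open>C_alg\<close>. Conversely, the matrix of all \<open>e_gen\<close> is positive and its square root is a
  norm limit of polynomials in it, so it has entries in \<open>C_alg\<close> and every unital *-representation
  maps the matrix to a sum of matrices of the form \<open>((T i)\<^sup>* (T j))\<close>.
\<close>

section \<open>Bounded operators and their adjoints\<close>

text \<open>The obstacle is the size of \<open>'h\<close>: the domains of the representations are
  closed subspaces of \<open>'u ell2\<close>, while \<open>'h\<close> is arbitrary, so in general no
  single representation can carry all of \<open>E\<close>. What has to be proved is local, however:
  an operator norm or a quadratic form is tested on finitely many vectors, and a separate embedding
  for each choice of vectors is enough. The price is that the homomorphism from the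
  \<open>e_gen\<close> to \<open>E\<close> is not obtained by restricting the universal
  representation to one reducing subspace. It is built as a relation, \<open>hom_graph\<close>, and
  one norm estimate yields both its single-valuedness and its extension to limits. In the other
  direction, the factorization of \<open>e_gen\<close> through \<open>gen\<close> cannot be pushed
  through \<pi>, because the \<open>gen\<close> lie outside \<open>C_alg\<close>. A factorization
  with entries in \<open>C_alg\<close> has to be found, and this is why the square root comes from
  an iteration that never leaves a given closed algebra. Conditions (i) and (iii) are linked only
  through (ii).\<close>

lemma cinner_add_right: "cinner x (y + z) = cinner x y + cinner x (z::'h::complex_hilbert)"
  using cinner_commute[of x] by (simp add: cinner_add_left)

lemma cinner_scaleC_right: "cinner x (c *\<^sub>C y) = cnj c * cinner x (y::'h::complex_hilbert)"
  using cinner_commute[of x] by (simp add: cinner_scaleC_left)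

lemma cinner_zero_right [simp]: "cinner (x::'h::complex_hilbert) 0 = 0"
  using cinner_add_right[of x 0 0] by simp

lemma cinner_minus_left: "cinner (- x) y = - cinner x (y::'h::complex_hilbert)"
  using cinner_add_left[of x "- x" y] by (simp add: eq_neg_iff_add_eq_0 add.commute)

lemma cinner_minus_right: "cinner x (- y) = - cinner x (y::'h::complex_hilbert)"
  using cinner_add_right[of x y "- y"] by (simp add: eq_neg_iff_add_eq_0 add.commute)

lemma cinner_diff_left: "cinner (x - y) z = cinner x z - cinner y (z::'h::complex_hilbert)"
  by (simp only: diff_conv_add_uminus cinner_add_left cinner_minus_left)

lemma cinner_diff_right: "cinner x (y - z) = cinner x y - cinner x (z::'h::complex_hilbert)"
  by (simp only: diff_conv_add_uminus cinner_add_right cinner_minus_right)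

lemma cinner_sum_left: "cinner (\<Sum>i\<in>I. f i) y = (\<Sum>i\<in>I. cinner (f i) (y::'h::complex_hilbert))"
  by (induction I rule: infinite_finite_induct) (simp_all add: cinner_add_left)

lemma cinner_sum_right: "cinner y (\<Sum>i\<in>I. f i) = (\<Sum>i\<in>I. cinner (y::'h::complex_hilbert) (f i))"
  by (induction I rule: infinite_finite_induct) (simp_all add: cinner_add_right)

lemmas cinner_simps = cinner_add_left cinner_add_right cinner_diff_left cinner_diff_right
  cinner_scaleC_left cinner_scaleC_right cinner_minus_left cinner_minus_right

lemma bounded_bilinear_cinner: "bounded_bilinear (cinner :: 'h::complex_hilbert \<Rightarrow> 'h \<Rightarrow> complex)"
  by (rule bounded_bilinear.intro)
    (auto simp: cinner_simps scaleR_scaleC scaleC_complex_def intro!: exI[of _ 1] norm_cinner_le)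

lemma cinner_left_eqI: "(\<And>z. cinner x z = cinner y z) \<Longrightarrow> x = (y::'h::complex_hilbert)"
  using cinner_self[of "x - y"] by (simp add: cinner_diff_left)

lemma cinner_right_eqI: "(\<And>z. cinner z x = cinner z y) \<Longrightarrow> x = (y::'h::complex_hilbert)"
  by (rule cinner_left_eqI) (metis cinner_commute)

text \<open>The representing vector minimizes \<open>F\<close>, which is the squared distance to the
  sought vector up to a constant. A minimizing sequence is Cauchy by the parallelogram law, and
  varying the minimizer along \<open>x\<close> gives the value of \<open>g x\<close>.\<close>

lemma inner_riesz:
  fixes g :: "'h::{real_inner, complete_space} \<Rightarrow> real"
  assumes "bounded_linear g"
  shows "\<exists>y. \<forall>x. g x = inner x y"
proof -
  interpret g: bounded_linear g by fact
  obtain K where K: "\<And>x. norm (g x) \<le> norm x * K" using g.bounded by blast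
  define F where "F x = (norm x)\<^sup>2 - 2 * g x" for x
  have lower: "- (K\<^sup>2) \<le> F x" for x
  proof -
    have "g x \<le> norm x * K" using K[of x] by simp
    moreover have "0 \<le> (norm x - K)\<^sup>2" by simp
    ultimately show ?thesis unfolding F_def power2_diff by linarith
  qed
  then have bdd: "bdd_below (range F)" by (meson bdd_belowI2)
  define m where "m = Inf (range F)"
  have m: "m \<le> F x" for x unfolding m_def by (rule cInf_lower[OF _ bdd]) simp
  have "\<exists>x. F x < m + inverse (real (Suc n))" for n
    using cInf_lessD[of "range F" "m + inverse (real (Suc n))"] by (force simp: m_def)
  then obtain X where X: "\<And>n. F (X n) < m + inverse (real (Suc n))" by metis
  \<comment> \<open>The parallelogram law; the linear terms of \<open>F\<close> cancel. Since the
    midpoint has \<open>F\<close> at least \<open>m\<close>, two nearly minimal points are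
    close.\<close>
  have par: "(norm (x - y))\<^sup>2 = 2 * F x + 2 * F y - 4 * F ((1/2) *\<^sub>R (x + y))" for x y
    unfolding F_def power2_norm_eq_inner
    by (simp add: inner_simps inner_commute g.add g.scaleR field_simps)
  have le: "(norm (X n - X k))\<^sup>2 \<le> 2 * inverse (real (Suc n)) + 2 * inverse (real (Suc k))" for n k
    unfolding par using X[of n] X[of k] m[of "(1/2) *\<^sub>R (X n + X k)"] by linarith
  have "Cauchy X"
  proof (rule CauchyI)
    fix e :: real assume e: "0 < e"
    obtain N where N: "inverse (real (Suc N)) < e\<^sup>2 / 4"
      using reals_Archimedean[of "e\<^sup>2 / 4"] e by auto
    have "norm (X n - X k) < e" if "n \<ge> N" "k \<ge> N" for n k
    proof -
      have "inverse (real (Suc n)) \<le> inverse (real (Suc N))"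
        "inverse (real (Suc k)) \<le> inverse (real (Suc N))"
        using that by (simp_all add: le_imp_inverse_le)
      then have "(norm (X n - X k))\<^sup>2 < e\<^sup>2" using le[of n k] N by linarith
      then show ?thesis using e by (simp add: power2_less_imp_less)
    qed
    then show "\<exists>M. \<forall>n\<ge>M. \<forall>k\<ge>M. norm (X n - X k) < e" by blast
  qed
  then obtain y where y: "X \<longlonglongrightarrow> y" using Cauchy_convergent convergent_def by blast
  have "(\<lambda>n. F (X n)) \<longlonglongrightarrow> F y"
    unfolding F_def by (intro tendsto_intros y g.tendsto)
  moreover have "(\<lambda>n. m + inverse (real (Suc n))) \<longlonglongrightarrow> m + 0"
    by (intro tendsto_intros LIMSEQ_inverse_real_of_nat)
  ultimately have "F y \<le> m + 0"
    by (rule LIMSEQ_le) (use X less_imp_le in blast)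
  then have Fy: "F y \<le> m" by simp
  have "g x = inner x y" for x
  proof (rule ccontr)
    assume ne: "g x \<noteq> inner x y"
    define d where "d = g x - inner x y"
    \<comment> \<open>Nearly the optimal step \<open>d / (norm x)^2\<close>; the added 1 avoids a
      case split on \<open>x = 0\<close> and still makes \<open>F\<close> drop strictly.\<close>
    define t where "t = d / ((norm x)\<^sup>2 + 1)"
    have "F (y + t *\<^sub>R x) = F y + t\<^sup>2 * (norm x)\<^sup>2 - 2 * t * d"
      unfolding F_def power2_norm_eq_inner d_def
      by (simp add: inner_simps inner_commute g.add g.scaleR power2_eq_square algebra_simps)
    moreover have pos: "0 < (norm x)\<^sup>2 + 1" by (simp add: add_nonneg_pos)
    then have d: "d = t * ((norm x)\<^sup>2 + 1)" by (simp add: t_def)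
    have "t * d = t\<^sup>2 * (norm x)\<^sup>2 + t\<^sup>2" unfolding d by (simp add: power2_eq_square algebra_simps)
    moreover have "0 < t\<^sup>2" using ne pos by (simp add: t_def d_def)
    moreover have "0 \<le> t\<^sup>2 * (norm x)\<^sup>2" by simp
    ultimately have "F (y + t *\<^sub>R x) < F y" by linarith
    then show False using Fy m[of "y + t *\<^sub>R x"] by linarith
  qed
  then show ?thesis by blast
qed

text \<open>A complex linear functional is determined by its real part: evaluating the latter at
  \<i> times \<open>x\<close> recovers the imaginary part. So the real version applied to
  \<open>Re\<close> of \<open>f\<close> suffices.\<close>

lemma cinner_riesz:
  fixes f :: "'h::complex_hilbert \<Rightarrow> complex"
  assumes "bounded_linear f" and "\<And>c x. f (c *\<^sub>C x) = c * f x"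
  shows "\<exists>y. \<forall>x. f x = cinner x y"
proof -
  obtain y where y: "\<And>x. Re (f x) = inner x y"
    using inner_riesz[OF bounded_linear_compose[OF bounded_linear_Re assms(1)]] by auto
  have "f x = cinner x y" for x
  proof (rule complex_eqI)
    show "Re (f x) = Re (cinner x y)" using y inner_eq_Re_cinner by metis
    have "Re (f (\<i> *\<^sub>C x)) = Re (cinner (\<i> *\<^sub>C x) y)" using y inner_eq_Re_cinner by metis
    then show "Im (f x) = Im (cinner x y)" by (simp add: assms(2) cinner_scaleC_left)
  qed
  then show ?thesis by blast
qed

section \<open>Algebra, norm and completeness of the space of bounded operators\<close>

lemma bounded_linear_cblinfun: "bounded_linear (cblinfun_apply T)"
  using cblinfun_apply[of T] by simp

lemmas cblinfun_apply_add = cblinfun_apply_linear(1)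
lemmas cblinfun_apply_scaleC = cblinfun_apply_linear(2)

lemma cblinfun_apply_zero [simp]: "T *\<^sub>V 0 = 0"
  by (simp add: linear_0 bounded_linear.linear bounded_linear_cblinfun)

lemma cblinfun_apply_diff: "T *\<^sub>V (x - y) = T *\<^sub>V x - T *\<^sub>V y"
  by (simp add: linear_diff bounded_linear.linear bounded_linear_cblinfun)

lemma cblinfun_apply_sum: "T *\<^sub>V (\<Sum>i\<in>I. f i) = (\<Sum>i\<in>I. T *\<^sub>V f i)"
  by (simp add: linear_sum bounded_linear.linear bounded_linear_cblinfun)

lemma cblinfun_sum_apply [simp]: "(\<Sum>i\<in>I. T i) *\<^sub>V x = (\<Sum>i\<in>I. T i *\<^sub>V x)"
  by (induction I rule: infinite_finite_induct) simp_all

lemma cblinfun_compose_apply [simp]: "(S o\<^sub>C T) *\<^sub>V x = S *\<^sub>V T *\<^sub>V x"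
  by (simp add: cblinfun_compose.rep_eq)

lemma id_op_apply [simp]: "id_op *\<^sub>V x = x"
  by (simp add: id_op.rep_eq)

lemma norm_cblinfun_apply_le: "norm (T *\<^sub>V x) \<le> norm T * norm x"
  unfolding norm_cblinfun.rep_eq by (rule onorm[OF bounded_linear_cblinfun])

lemma norm_cblinfun_leI: "0 \<le> b \<Longrightarrow> (\<And>x. norm (T *\<^sub>V x) \<le> b * norm x) \<Longrightarrow> norm T \<le> b"
  unfolding norm_cblinfun.rep_eq by (rule onorm_bound)

lemma norm_scaleC_cblinfun:
  "norm (c *\<^sub>C T) = cmod c * norm (T :: 'h::complex_hilbert \<Rightarrow>\<^sub>C\<^sub>L 'k::complex_hilbert)"
proof -
  have le: "norm (c *\<^sub>C T) \<le> cmod c * norm T" for c and T :: "'h \<Rightarrow>\<^sub>C\<^sub>L 'k"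
    by (rule norm_cblinfun_leI)
      (simp_all add: norm_scaleC mult.assoc mult_left_mono norm_cblinfun_apply_le)
  show ?thesis
  proof (cases "c = 0")
    case True
    then show ?thesis by (simp add: complex_vector.scale_zero_left)
  next
    case False
    have "norm (inverse c *\<^sub>C c *\<^sub>C T) \<le> cmod (inverse c) * norm (c *\<^sub>C T)" by (rule le)
    then have "cmod c * norm T \<le> norm (c *\<^sub>C T)"
      using False by (simp add: complex_vector.scale_one norm_inverse pos_le_divide_eq
        divide_inverse_commute[symmetric] mult.commute)
    then show ?thesis using le[of c T] by simp
  qed
qed

lemma norm_cblinfun_compose_le: "norm (S o\<^sub>C T) \<le> norm S * norm T"
  by (rule norm_cblinfun_leI)
    (auto simp: mult.assoc intro!: order.trans[OF norm_cblinfun_apply_le] mult_left_mono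
      norm_cblinfun_apply_le)

lemma bounded_linear_scaleC_cblinfun:
  "bounded_linear (\<lambda>T. c *\<^sub>C T :: 'h::complex_hilbert \<Rightarrow>\<^sub>C\<^sub>L 'k::complex_hilbert)"
  by (rule bounded_linear_intro[where K = "cmod c"])
    (simp_all add: scaleC_add_right scaleR_scaleC scaleC_scaleC norm_scaleC_cblinfun mult.commute)

lemma bounded_bilinear_cblinfun_compose: "bounded_bilinear (o\<^sub>C)"
  by (rule bounded_bilinear.intro)
    (auto intro!: cblinfun_eqI exI[of _ 1] norm_cblinfun_compose_le
      simp: cblinfun_apply_add cblinfun_apply_scaleC scaleR_scaleC)

lemma scaleC_cblinfun_compose_left: "(c *\<^sub>C S) o\<^sub>C T = c *\<^sub>C (S o\<^sub>C T)"
  and scaleC_cblinfun_compose_right: "S o\<^sub>C (c *\<^sub>C T) = c *\<^sub>C (S o\<^sub>C T)"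
  by (auto intro: cblinfun_eqI simp: cblinfun_apply_scaleC)

lemmas cblinfun_compose_add_left = bounded_bilinear.add_left[OF bounded_bilinear_cblinfun_compose]
lemmas cblinfun_compose_add_right = bounded_bilinear.add_right[OF bounded_bilinear_cblinfun_compose]
lemmas cblinfun_compose_diff_left = bounded_bilinear.diff_left[OF bounded_bilinear_cblinfun_compose]
lemmas cblinfun_compose_diff_right = bounded_bilinear.diff_right[OF bounded_bilinear_cblinfun_compose]

lemma cblinfun_compose_assoc: "(R o\<^sub>C S) o\<^sub>C T = R o\<^sub>C (S o\<^sub>C T)"
  by (rule cblinfun_eqI) simp

lemma cblinfun_compose_id [simp]: "id_op o\<^sub>C T = T" "T o\<^sub>C id_op = T"
  by (rule cblinfun_eqI; simp)+

instance complex_hilbert \<subseteq> banach ..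

text \<open>The norm agrees with that of the real bounded operators \<open>blinfun\<close>, which
  are complete, and complex homogeneity survives pointwise limits.\<close>

instance cblinfun :: (complex_hilbert, complex_hilbert) complete_space
proof
  fix X :: "nat \<Rightarrow> ('a \<Rightarrow>\<^sub>C\<^sub>L 'b)"
  assume X: "Cauchy X"
  have norm_eq: "norm (Blinfun (cblinfun_apply T)) = norm T" for T :: "'a \<Rightarrow>\<^sub>C\<^sub>L 'b"
    by (simp add: norm_blinfun.rep_eq norm_cblinfun.rep_eq bounded_linear_Blinfun_apply
        bounded_linear_cblinfun)
  have diff: "Blinfun (cblinfun_apply S) - Blinfun (cblinfun_apply T)
      = Blinfun (cblinfun_apply (S - T))" for S T :: "'a \<Rightarrow>\<^sub>C\<^sub>L 'b"
    by (rule blinfun_eqI)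
      (simp add: bounded_linear_Blinfun_apply bounded_linear_cblinfun blinfun.diff_left
        bounded_linear_sub)
  define Y where "Y n = Blinfun (cblinfun_apply (X n))" for n
  have dist_eq: "dist (Y m) (Y n) = dist (X m) (X n)" for m n
    unfolding dist_norm Y_def diff norm_eq ..
  have "Cauchy Y" using X by (simp add: Cauchy_def dist_eq)
  then obtain L where L: "Y \<longlonglongrightarrow> L" using Cauchy_convergent convergent_def by blast
  have lim: "(\<lambda>n. X n *\<^sub>V \<xi>) \<longlonglongrightarrow> blinfun_apply L \<xi>" for \<xi>
  proof -
    have "(\<lambda>n. blinfun_apply (Y n) \<xi>) \<longlonglongrightarrow> blinfun_apply L \<xi>"
      by (intro tendsto_intros L)
    then show ?thesis
      by (simp add: Y_def bounded_linear_Blinfun_apply bounded_linear_cblinfun)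
  qed
  have "blinfun_apply L (c *\<^sub>C \<xi>) = c *\<^sub>C blinfun_apply L \<xi>" for c \<xi>
  proof (rule LIMSEQ_unique[OF lim])
    show "(\<lambda>n. X n *\<^sub>V c *\<^sub>C \<xi>) \<longlonglongrightarrow> c *\<^sub>C blinfun_apply L \<xi>"
      unfolding cblinfun_apply_scaleC
      by (rule bounded_linear.tendsto[OF bounded_linear_scaleC lim])
  qed
  then have M: "cblinfun_apply (CBlinfun (blinfun_apply L)) = blinfun_apply L"
    by (intro CBlinfun_inverse) (simp add: blinfun.bounded_linear_right)
  have "dist (X n) (CBlinfun (blinfun_apply L)) = dist (Y n) L" for n
    unfolding dist_norm Y_def norm_eq[symmetric] diff[symmetric] M blinfun_apply_inverse ..
  then have "X \<longlonglongrightarrow> CBlinfun (blinfun_apply L)"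
    using L by (simp add: LIMSEQ_def)
  then show "convergent X" by (rule convergentI)
qed

text \<open>For fixed \<eta> the Riesz vector of the functional on the left is the only candidate
  for the value at \<eta>. Its linearity in \<eta> comes from uniqueness, its boundedness from the
  Cauchy-Schwarz inequality applied to \<open>f x\<close> itself.\<close>

lemma adj_ex1:
  fixes T :: "'h::complex_hilbert \<Rightarrow>\<^sub>C\<^sub>L 'k::complex_hilbert"
  shows "\<exists>!S. \<forall>\<xi> \<eta>. cinner (T *\<^sub>V \<xi>) \<eta> = cinner \<xi> (S *\<^sub>V \<eta>)"
proof (rule ex_ex1I)
  have "\<exists>y. \<forall>\<xi>. cinner (T *\<^sub>V \<xi>) \<eta> = cinner \<xi> y" for \<eta>
    by (rule cinner_riesz)
      (simp_all add: cblinfun_apply_scaleC cinner_scaleC_left bounded_linear_compose[OF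
        bounded_bilinear.bounded_linear_left[OF bounded_bilinear_cinner] bounded_linear_cblinfun])
  then obtain f where f: "\<And>\<xi> \<eta>. cinner (T *\<^sub>V \<xi>) \<eta> = cinner \<xi> (f \<eta>)" by metis
  have scaleC: "f (c *\<^sub>C \<eta>) = c *\<^sub>C f \<eta>" for c \<eta>
    by (rule cinner_right_eqI) (simp add: f[symmetric] cinner_simps)
  have "bounded_linear f"
  proof (rule bounded_linear_intro[where K = "norm T"])
    show "f (x + y) = f x + f y" for x y
      by (rule cinner_right_eqI) (simp add: f[symmetric] cinner_simps)
    show "f (r *\<^sub>R x) = r *\<^sub>R f x" for r x by (simp add: scaleR_scaleC scaleC)
    show "norm (f x) \<le> norm x * norm T" for x
    proof (cases "f x = 0")
      case False
      have "(norm (f x))\<^sup>2 = cmod (cinner (T *\<^sub>V f x) x)" by (simp add: f cinner_self norm_power)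
      also have "\<dots> \<le> norm (T *\<^sub>V f x) * norm x" by (rule norm_cinner_le)
      also have "\<dots> \<le> norm T * norm (f x) * norm x"
        by (intro mult_right_mono norm_cblinfun_apply_le) simp
      finally show ?thesis using False by (simp add: power2_eq_square algebra_simps)
    qed simp
  qed
  then have "cblinfun_apply (CBlinfun f) = f" by (intro CBlinfun_inverse) (simp add: scaleC)
  then show "\<exists>S. \<forall>\<xi> \<eta>. cinner (T *\<^sub>V \<xi>) \<eta> = cinner \<xi> (S *\<^sub>V \<eta>)"
    using f by (intro exI[of _ "CBlinfun f"]) simp
next
  fix S S'
  assume "\<forall>\<xi> \<eta>. cinner (T *\<^sub>V \<xi>) \<eta> = cinner \<xi> (S *\<^sub>V \<eta>)" "\<forall>\<xi> \<eta>. cinner (T *\<^sub>V \<xi>) \<eta> = cinner \<xi> (S' *\<^sub>V \<eta>)"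
  then have "cinner \<xi> (S *\<^sub>V \<eta>) = cinner \<xi> (S' *\<^sub>V \<eta>)" for \<xi> \<eta> by simp
  then show "S = S'" by (rule cblinfun_eqI[OF cinner_right_eqI])
qed

lemma cinner_adj_right: "cinner \<xi> (adj T *\<^sub>V \<eta>) = cinner (T *\<^sub>V \<xi>) \<eta>"
  unfolding adj_def by (rule theI'[OF adj_ex1[of T], rule_format, symmetric])

lemma cinner_adj_left: "cinner (adj T *\<^sub>V \<eta>) \<xi> = cinner \<eta> (T *\<^sub>V \<xi>)"
  using cinner_adj_right[of \<xi> T \<eta>] by (metis cinner_commute)

lemma adj_eqI: "(\<And>\<xi> \<eta>. cinner (T *\<^sub>V \<xi>) \<eta> = cinner \<xi> (S *\<^sub>V \<eta>)) \<Longrightarrow> adj T = S"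
  by (rule cblinfun_eqI[OF cinner_right_eqI]) (simp add: cinner_adj_right)

lemma adj_adj [simp]: "adj (adj T) = T"
  by (rule adj_eqI) (rule cinner_adj_left)

lemma adj_add: "adj (S + T) = adj S + adj T"
  by (rule adj_eqI) (simp add: cinner_simps cinner_adj_right)

lemma adj_diff: "adj (S - T) = adj S - adj T"
  by (rule adj_eqI) (simp add: cinner_simps cinner_adj_right)

lemma adj_scaleC: "adj (c *\<^sub>C T) = cnj c *\<^sub>C adj T"
  by (rule adj_eqI) (simp add: cinner_simps cinner_adj_right)

lemma adj_compose: "adj (S o\<^sub>C T) = adj T o\<^sub>C adj S"
  by (rule adj_eqI) (simp add: cinner_adj_right)

lemma adj_id [simp]: "adj id_op = id_op"
  by (rule adj_eqI) simp

lemma norm_adj_le: "norm (adj T) \<le> norm T"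
proof (rule norm_cblinfun_leI)
  fix \<eta>
  show "norm (adj T *\<^sub>V \<eta>) \<le> norm T * norm \<eta>"
  proof (cases "adj T *\<^sub>V \<eta> = 0")
    case False
    have "(norm (adj T *\<^sub>V \<eta>))\<^sup>2 = cmod (cinner (T *\<^sub>V adj T *\<^sub>V \<eta>) \<eta>)"
      by (simp add: cinner_adj_right[symmetric] cinner_self norm_power)
    also have "\<dots> \<le> norm (T *\<^sub>V adj T *\<^sub>V \<eta>) * norm \<eta>" by (rule norm_cinner_le)
    also have "\<dots> \<le> norm T * norm (adj T *\<^sub>V \<eta>) * norm \<eta>"
      by (intro mult_right_mono norm_cblinfun_apply_le) simp
    finally show ?thesis using False by (simp add: power2_eq_square algebra_simps)
  qed simp
qed simp

lemma bounded_linear_adj: "bounded_linear adj"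
  by (rule bounded_linear_intro[where K = 1])
    (simp_all add: adj_add scaleR_scaleC adj_scaleC norm_adj_le)

section \<open>Coordinates for positive forms\<close>

context
  fixes P :: "'w::complex_hilbert \<Rightarrow>\<^sub>C\<^sub>L 'w"
  assumes positive: "\<And>v. cinner (P *\<^sub>V v) v \<in> \<real>\<^sub>\<ge>\<^sub>0"
begin

abbreviation (input) form where "form v w \<equiv> cinner (P *\<^sub>V v) w"

lemma form_self: "form v v = complex_of_real (Re (form v v))"
  using positive[of v] by (auto simp: complex_nonneg_Reals_iff complex_eq_iff)

lemma form_self_nonneg: "0 \<le> Re (form v v)"
  using positive[of v] by (simp add: complex_nonneg_Reals_iff)

text \<open>Hermitian symmetry follows from real diagonal values alone: the value at
  \<open>v + w\<close> gives the imaginary part, the value at \<open>v\<close> plus \<i> times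
  \<open>w\<close> the real part.\<close>

lemma form_commute: "form w v = cnj (form v w)"
proof (rule complex_eqI)
  have im: "Im (form v v) = 0" for v
    using positive[of v] by (simp add: complex_nonneg_Reals_iff)
  show "Im (form w v) = Im (cnj (form v w))"
    using im[of "v + w"] im[of v] im[of w] by (simp add: cblinfun_apply_add cinner_simps)
  show "Re (form w v) = Re (cnj (form v w))"
    using im[of "v + \<i> *\<^sub>C w"] im[of v] im[of "\<i> *\<^sub>C w"]
    by (simp add: cblinfun_apply_add cblinfun_apply_scaleC cinner_simps)
qed

lemma form_simps:
  "form (v + w) u = form v u + form w u" "form u (v + w) = form u v + form u w"
  "form (v - w) u = form v u - form w u" "form u (v - w) = form u v - form u w"
  "form (c *\<^sub>C v) u = c * form v u" "form u (c *\<^sub>C v) = cnj c * form u v"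
  by (simp_all add: cblinfun_apply_add cblinfun_apply_scaleC cblinfun_apply_diff cinner_simps)

text \<open>The parallelogram law with the nonnegative term of \<open>v - w\<close> dropped. It
  shows below that null vectors are closed under sums.\<close>

lemma form_self_add_le: "Re (form (v + w) (v + w)) \<le> 2 * Re (form v v) + 2 * Re (form w w)"
  using form_self_nonneg[of "v - w"] by (simp add: form_simps)

definition normalized :: "'w \<Rightarrow> 'w" where
  "normalized r = complex_of_real (1 / sqrt (Re (form r r))) *\<^sub>C r"

lemma form_normalized:
  assumes "Re (form r r) \<noteq> 0"
  shows "form (normalized r) (normalized r) = 1"
proof -
  define s where "s = sqrt (Re (form r r))"
  have s: "Re (form r r) = s * s" using form_self_nonneg[of r] by (simp add: s_def)
  have "form (normalized r) (normalized r) = complex_of_real (1 / s * (1 / s)) * form r r"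
    unfolding normalized_def s_def[symmetric] form_simps by simp
  also have "\<dots> = complex_of_real (1 / s * (1 / s) * (s * s))"
    by (subst form_self) (simp add: s)
  finally show ?thesis using assms s by simp
qed

lemma normalized_null: "Re (form r r) = 0 \<Longrightarrow> normalized r = 0"
  by (simp add: normalized_def complex_vector.scale_zero_left)

context
  fixes h :: "nat \<Rightarrow> 'w"
begin

text \<open>Gram--Schmidt for the possibly degenerate form: the residual of \<open>v\<close> after the first \<open>n\<close>
  normalized residuals of \<open>h 0, h 1, \<dots>\<close> have been split off. The null vectors contribute nothing
  because of \<open>1 / 0 = 0\<close>.\<close>

primrec residual :: "nat \<Rightarrow> 'w \<Rightarrow> 'w" where
  "residual 0 v = v"
| "residual (Suc n) v = residual n v -
    form (residual n v) (normalized (residual n (h n))) *\<^sub>C normalized (residual n (h n))"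

text \<open>The coordinate of \<open>v\<close> along the \<open>n\<close>-th normalized residual.
  Pairing with \<open>residual n v\<close> instead of \<open>v\<close> builds orthogonality into the
  recursion, so each step of the computation involves only the current vector.\<close>

definition coefficient :: "nat \<Rightarrow> 'w \<Rightarrow> complex" where
  "coefficient n v = form (residual n v) (normalized (residual n (h n)))"

lemma residual_add: "residual n (v + w) = residual n v + residual n w"
  by (induction n) (simp_all add: form_simps scaleC_add_left)

lemma residual_scaleC: "residual n (c *\<^sub>C v) = c *\<^sub>C residual n v"
  by (induction n)
    (simp_all add: form_simps scaleC_scaleC complex_vector.scale_right_diff_distrib)

lemma coefficient_add: "coefficient n (v + w) = coefficient n v + coefficient n w"
  and coefficient_scaleC: "coefficient n (c *\<^sub>C v) = c * coefficient n v"
  by (simp_all add: coefficient_def residual_add residual_scaleC form_simps)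

text \<open>Pythagoras for one step. The vector \<open>e\<close> split off is either of length 1 for
  the form or zero, and in the second case the coefficient vanishes as well.\<close>

lemma form_residual_Suc:
  "Re (form (residual (Suc n) v) (residual (Suc n) v)) =
    Re (form (residual n v) (residual n v)) - (cmod (coefficient n v))\<^sup>2"
proof -
  define r where "r = residual n v"
  define e where "e = normalized (residual n (h n))"
  define c where "c = form r e"
  have Suc: "residual (Suc n) v = r - c *\<^sub>C e" and c_eq: "coefficient n v = c"
    by (simp_all add: r_def e_def c_def coefficient_def)
  have "form e e = 1 \<or> e = 0"
    unfolding e_def using form_normalized normalized_null by blast
  then have "c * cnj c * form e e = c * cnj c"
    by (auto simp: c_def)
  then have "form (r - c *\<^sub>C e) (r - c *\<^sub>C e) = form r r - c * cnj c"
    using form_commute[of e r] by (simp add: form_simps c_def[symmetric] algebra_simps)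
  then show ?thesis
    unfolding Suc c_eq r_def[symmetric] by (simp add: complex_mult_cnj cmod_power2)
qed

lemma form_eq_sum_coefficients:
  "Re (form v v) = (\<Sum>k<n. (cmod (coefficient k v))\<^sup>2) + Re (form (residual n v) (residual n v))"
  by (induction n) (simp_all only: form_residual_Suc, simp_all)

text \<open>At stage \<open>m\<close> the vector split off is the normalized residual of
  \<open>h m\<close> itself, so nothing but a null vector is left of \<open>h m\<close>. Afterwards
  the length of the residual cannot grow.\<close>

lemma form_residual_generator:
  assumes "m < n"
  shows "Re (form (residual n (h m)) (residual n (h m))) = 0"
  using assms
proof (induction n)
  case (Suc n)
  show ?case
  proof (cases "m = n")
    case True
    define r where "r = residual n (h n)"
    have "Re (form (r - form r (normalized r) *\<^sub>C normalized r)
        (r - form r (normalized r) *\<^sub>C normalized r)) = 0"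
    proof (cases "Re (form r r) = 0")
      case True
      then show ?thesis by (simp add: normalized_null complex_vector.scale_zero_left)
    next
      case False
      define s where "s = sqrt (Re (form r r))"
      have s: "s * s = Re (form r r)" "s \<noteq> 0"
        using form_self_nonneg[of r] False by (simp_all add: s_def)
      have "form r (normalized r) = complex_of_real (1 / s) * form r r"
        by (simp add: normalized_def s_def form_simps)
      also have "\<dots> = complex_of_real s"
        using s by (subst form_self) (simp flip: s(1))
      finally have "form r (normalized r) *\<^sub>C normalized r = r"
        using s by (simp add: normalized_def s_def[symmetric] scaleC_scaleC scaleC_one)
      then show ?thesis by simp
    qed
    then show ?thesis using True by (simp add: r_def)
  next
    case False
    then show ?thesis
      using Suc form_residual_Suc[of n "h m"] form_self_nonneg[of "residual (Suc n) (h m)"]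
        zero_le_power2[of "cmod (coefficient n (h m))"]
      by linarith
  qed
qed simp

text \<open>A linear combination involves finitely many \<open>h m\<close>, so from some stage on
  the residuals of all its terms are null, and null vectors form a subspace.\<close>

lemma form_residual_cspan:
  assumes "v \<in> cspan (range h)"
  shows "\<exists>N. \<forall>n\<ge>N. Re (form (residual n v) (residual n v)) = 0"
  using assms
proof (induction rule: complex_vector.span_induct_alt)
  case base
  have "residual n 0 = 0" for n
    using residual_scaleC[of n 0 0] by (simp add: complex_vector.scale_zero_left)
  then show ?case by simp
next
  case (step c x y)
  then obtain m N where x: "x = h m"
    and N: "\<And>n. n \<ge> N \<Longrightarrow> Re (form (residual n y) (residual n y)) = 0" by blast
  have "Re (form (residual n (c *\<^sub>C x + y)) (residual n (c *\<^sub>C x + y))) = 0"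
    if "n \<ge> max N (Suc m)" for n
  proof -
    have "form (residual n (h m)) (residual n (h m)) = 0"
      using form_residual_generator[of m n] that by (subst form_self) simp
    then have "Re (form (c *\<^sub>C residual n x) (c *\<^sub>C residual n x)) = 0"
      by (simp add: x form_simps)
    then show ?thesis
      using form_self_add_le[of "c *\<^sub>C residual n x" "residual n y"] N[of n] that
        form_self_nonneg[of "residual n (c *\<^sub>C x + y)"]
      by (simp add: residual_add residual_scaleC)
  qed
  then show ?case by blast
qed

text \<open>Bessel's inequality, with equality on the span because there the residual becomes null
  after finitely many steps.\<close>

lemma coefficient_square_sums:
  "(\<lambda>n. (cmod (coefficient n v))\<^sup>2) summable_on UNIV"
  "(\<Sum>\<^sub>\<infinity>n. (cmod (coefficient n v))\<^sup>2) \<le> Re (form v v)"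
  "v \<in> cspan (range h) \<Longrightarrow> (\<Sum>\<^sub>\<infinity>n. (cmod (coefficient n v))\<^sup>2) = Re (form v v)"
proof -
  have fin: "(\<Sum>k\<in>F. (cmod (coefficient k v))\<^sup>2) \<le> Re (form v v)" if F: "finite F" for F
  proof -
    obtain n where "F \<subseteq> {..<n}" using finite_nat_bounded[OF F] by blast
    then have "(\<Sum>k\<in>F. (cmod (coefficient k v))\<^sup>2) \<le> (\<Sum>k<n. (cmod (coefficient k v))\<^sup>2)"
      by (intro sum_mono2) simp_all
    also have "\<dots> \<le> Re (form v v)"
      using form_eq_sum_coefficients[of v n] form_self_nonneg[of "residual n v"] by linarith
    finally show ?thesis .
  qed
  show summable: "(\<lambda>n. (cmod (coefficient n v))\<^sup>2) summable_on UNIV"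
    by (rule nonneg_bounded_partial_sums_imp_summable_on[where C = "Re (form v v)"])
      (auto intro!: eventually_finite_subsets_at_top_weakI fin)
  show le: "(\<Sum>\<^sub>\<infinity>n. (cmod (coefficient n v))\<^sup>2) \<le> Re (form v v)"
    by (rule infsum_le_finite_sums[OF summable fin])
  assume "v \<in> cspan (range h)"
  then obtain n where "Re (form (residual n v) (residual n v)) = 0"
    using form_residual_cspan by blast
  then have "Re (form v v) = (\<Sum>k<n. (cmod (coefficient k v))\<^sup>2)"
    using form_eq_sum_coefficients[of v n] by simp
  also have "\<dots> \<le> (\<Sum>\<^sub>\<infinity>n. (cmod (coefficient n v))\<^sup>2)"
    by (rule finite_sum_le_infsum[OF summable]) simp_all
  finally show "(\<Sum>\<^sub>\<infinity>n. (cmod (coefficient n v))\<^sup>2) = Re (form v v)" using le by simp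
qed

text \<open>The coefficient sequence is square summable and linear in \<open>v\<close>, hence a
  vector of the sequence space; an injection of \<open>nat\<close> into the infinite type
  \<open>'u\<close>, with zeros off its range, moves it to \<open>'u ell2\<close>.\<close>

lemma cspan_coordinates:
  obtains U :: "'w \<Rightarrow>\<^sub>C\<^sub>L 'u::infinite ell2"
  where "\<And>v. (norm (U *\<^sub>V v))\<^sup>2 \<le> Re (form v v)"
    and "\<And>v. v \<in> cspan (range h) \<Longrightarrow> (norm (U *\<^sub>V v))\<^sup>2 = Re (form v v)"
proof -
  obtain \<iota> :: "nat \<Rightarrow> 'u" where \<iota>: "inj \<iota>"
    using infinite_UNIV infinite_countable_subset by blast
  define f where "f v u = (if u \<in> range \<iota> then coefficient (inv \<iota> u) v else 0)" for v u
  have range: "(\<lambda>u. (cmod (f v u))\<^sup>2) summable_on range \<iota>"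
    "(\<Sum>\<^sub>\<infinity>u\<in>range \<iota>. (cmod (f v u))\<^sup>2) = (\<Sum>\<^sub>\<infinity>n. (cmod (coefficient n v))\<^sup>2)" for v
    using \<iota> coefficient_square_sums(1)[of v]
    by (simp_all add: summable_on_reindex infsum_reindex o_def f_def)
  have "(\<lambda>u. (cmod (f v u))\<^sup>2) summable_on UNIV" for v
    by (rule iffD1[OF summable_on_cong_neutral range(1)]) (auto simp: f_def)
  then have comp: "component (Hilbert_Sum (f v)) = f v" for v
    by (simp add: Hilbert_Sum_inverse)
  have norm: "(norm (Hilbert_Sum (f v)))\<^sup>2 = (\<Sum>\<^sub>\<infinity>n. (cmod (coefficient n v))\<^sup>2)" for v
    unfolding norm_hilbert_sum_square comp range(2)[symmetric]
    by (rule infsum_cong_neutral) (auto simp: f_def)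
  have le: "(norm (Hilbert_Sum (f v)))\<^sup>2 \<le> Re (form v v)" for v
    unfolding norm by (rule coefficient_square_sums)
  have scaleC: "Hilbert_Sum (f (c *\<^sub>C v)) = c *\<^sub>C Hilbert_Sum (f v)" for c v
    by (rule hilbert_sum_eqI) (simp add: comp f_def coefficient_scaleC scaleC_complex_def)
  \<comment> \<open>The bound comes from Bessel: the square of the norm is at most the form at
    \<open>v\<close>, hence at most \<open>norm P\<close> times \<open>(norm v)^2\<close>.\<close>
  have "bounded_linear (\<lambda>v. Hilbert_Sum (f v))"
  proof (rule bounded_linear_intro[where K = "sqrt (norm P)"])
    show "Hilbert_Sum (f (v + w)) = Hilbert_Sum (f v) + Hilbert_Sum (f w)" for v w
      by (rule hilbert_sum_eqI) (simp add: comp f_def coefficient_add)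
    show "Hilbert_Sum (f (r *\<^sub>R v)) = r *\<^sub>R Hilbert_Sum (f v)" for r v
      by (simp add: scaleR_scaleC scaleC)
    show "norm (Hilbert_Sum (f v)) \<le> norm v * sqrt (norm P)" for v
    proof (rule power2_le_imp_le)
      have "(norm (Hilbert_Sum (f v)))\<^sup>2 \<le> cmod (form v v)"
        using le complex_Re_le_cmod order.trans by blast
      also have "\<dots> \<le> norm (P *\<^sub>V v) * norm v" by (rule norm_cinner_le)
      also have "\<dots> \<le> norm P * norm v * norm v"
        by (intro mult_right_mono norm_cblinfun_apply_le) simp
      finally show "(norm (Hilbert_Sum (f v)))\<^sup>2 \<le> (norm v * sqrt (norm P))\<^sup>2"
        by (simp add: power_mult_distrib power2_eq_square mult.commute mult.left_commute)
    qed simp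
  qed
  then have "cblinfun_apply (CBlinfun (\<lambda>v. Hilbert_Sum (f v))) = (\<lambda>v. Hilbert_Sum (f v))"
    by (intro CBlinfun_inverse) (simp add: scaleC)
  then show thesis
    by (intro that[of "CBlinfun (\<lambda>v. Hilbert_Sum (f v))"])
      (simp_all add: norm coefficient_square_sums(2,3))
qed

end

end

text \<open>Formulated for binary operations and with convergent sequences, so that
  \<open>tendsto\<close> rules apply directly; a unary operation is treated as a binary one that
  ignores its second argument.\<close>

lemma closure_operation:
  fixes f :: "'v::first_countable_topology \<Rightarrow> 'w::first_countable_topology \<Rightarrow> 'z::first_countable_topology"
  assumes "\<And>X Y x y. X \<longlonglongrightarrow> x \<Longrightarrow> Y \<longlonglongrightarrow> y \<Longrightarrow> (\<lambda>n. f (X n) (Y n)) \<longlonglongrightarrow> f x y"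
    and "\<And>x y. x \<in> S \<Longrightarrow> y \<in> T \<Longrightarrow> f x y \<in> U" and "x \<in> closure S" "y \<in> closure T"
  shows "f x y \<in> closure U"
proof -
  obtain X Y where "\<And>n. X n \<in> S" "\<And>n. Y n \<in> T" "X \<longlonglongrightarrow> x" "Y \<longlonglongrightarrow> y"
    using assms(3,4) unfolding closure_sequential by blast
  then show ?thesis
    unfolding closure_sequential using assms(1,2)
    by (intro exI[of _ "\<lambda>n. f (X n) (Y n)"]) auto
qed

text \<open>The two classes do not relate \<open>scaleC\<close> to the norm, so its continuity
  enters as a hypothesis, discharged for vectors and for operators right below.\<close>

lemma csubspace_closure:
  fixes S :: "'v::{complex_vector, real_normed_vector} set"
  assumes "csubspace S" and "\<And>c. bounded_linear (\<lambda>x. c *\<^sub>C x :: 'v)"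
  shows "csubspace (closure S)"
proof (rule complex_vector.subspaceI)
  show "0 \<in> closure S" using complex_vector.subspace_0[OF assms(1)] closure_subset by blast
  show "x + y \<in> closure S" if "x \<in> closure S" "y \<in> closure S" for x y
    by (rule closure_operation[OF tendsto_add complex_vector.subspace_add[OF assms(1)] that])
  show "c *\<^sub>C x \<in> closure S" if "x \<in> closure S" for c x
    by (rule closure_operation[of "\<lambda>x _. c *\<^sub>C x", OF bounded_linear.tendsto[OF assms(2)]
      complex_vector.subspace_scale[OF assms(1)] that that])
qed

lemmas csubspace_closure_hilbert = csubspace_closure[OF _ bounded_linear_scaleC]
lemmas csubspace_closure_cblinfun = csubspace_closure[OF _ bounded_linear_scaleC_cblinfun]

text \<open>The diagonal at \<open>v + w\<close> determines \<open>F v w + F w v\<close>; the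
  diagonal at \<open>v\<close> plus \<i> times \<open>w\<close> determines the difference of the
  two. Both points stay in the subspace \<open>S\<close>.\<close>

lemma polarization:
  fixes F G :: "'w::complex_vector \<Rightarrow> 'w \<Rightarrow> complex"
  assumes "csubspace S" "v \<in> S" "w \<in> S"
    and F: "\<And>u v w. F (u + v) w = F u w + F v w" "\<And>u v w. F w (u + v) = F w u + F w v"
      "\<And>c v w. F (c *\<^sub>C v) w = c * F v w" "\<And>c v w. F v (c *\<^sub>C w) = cnj c * F v w"
    and G: "\<And>u v w. G (u + v) w = G u w + G v w" "\<And>u v w. G w (u + v) = G w u + G w v"
      "\<And>c v w. G (c *\<^sub>C v) w = c * G v w" "\<And>c v w. G v (c *\<^sub>C w) = cnj c * G v w"
    and eq: "\<And>v. v \<in> S \<Longrightarrow> F v v = G v v"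
  shows "F v w = G v w"
proof -
  have 1: "v + w \<in> S" "v + \<i> *\<^sub>C w \<in> S"
    using assms(1-3) by (simp_all add: complex_vector.subspace_add complex_vector.subspace_scale)
  have "F v w + F w v = G v w + G w v"
    using eq[OF 1(1)] eq[OF assms(2)] eq[OF assms(3)] by (simp add: F(1,2) G(1,2) add.commute)
  moreover have "- \<i> * F v w + \<i> * F w v = - \<i> * G v w + \<i> * G w v"
    using eq[OF 1(2)] eq[OF assms(2)] eq[OF assms(3)] by (simp add: F G algebra_simps)
  then have "\<i> * (- F v w + F w v) = \<i> * (- G v w + G w v)"
    by (simp add: algebra_simps)
  then have "- F v w + F w v = - G v w + G w v" by simp
  ultimately have "2 * F v w = 2 * G v w" by algebra
  then show ?thesis by simp
qed

text \<open>Equality of the squared norm with the form is a closed condition on \<open>v\<close>, so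
  it passes from the span to its closure; polarization there turns it into equality of inner
  products.\<close>

lemma closure_cspan_coordinates:
  fixes P :: "'w::complex_hilbert \<Rightarrow>\<^sub>C\<^sub>L 'w" and h :: "nat \<Rightarrow> 'w"
  assumes "\<And>v. cinner (P *\<^sub>V v) v \<in> \<real>\<^sub>\<ge>\<^sub>0"
  obtains U :: "'w \<Rightarrow>\<^sub>C\<^sub>L 'u::infinite ell2"
  where "\<And>v. (norm (U *\<^sub>V v))\<^sup>2 \<le> Re (cinner (P *\<^sub>V v) v)"
    and "\<And>v w. v \<in> closure (cspan (range h)) \<Longrightarrow> w \<in> closure (cspan (range h)) \<Longrightarrow>
      cinner (U *\<^sub>V v) (U *\<^sub>V w) = cinner (P *\<^sub>V v) w"
proof -
  obtain U :: "'w \<Rightarrow>\<^sub>C\<^sub>L 'u ell2"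
    where le: "\<And>v. (norm (U *\<^sub>V v))\<^sup>2 \<le> Re (cinner (P *\<^sub>V v) v)"
      and eq: "\<And>v. v \<in> cspan (range h) \<Longrightarrow> (norm (U *\<^sub>V v))\<^sup>2 = Re (cinner (P *\<^sub>V v) v)"
    using cspan_coordinates[OF assms, of h thesis] by blast
  have "closed {v. (norm (U *\<^sub>V v))\<^sup>2 = Re (cinner (P *\<^sub>V v) v)}"
    by (intro closed_Collect_eq continuous_intros linear_continuous_on
      bounded_bilinear.continuous_on[OF bounded_bilinear_cinner] bounded_linear_cblinfun)
  then have norm_eq: "(norm (U *\<^sub>V v))\<^sup>2 = Re (cinner (P *\<^sub>V v) v)"
    if "v \<in> closure (cspan (range h))" for v
    using closure_minimal[of "cspan (range h)" "{v. (norm (U *\<^sub>V v))\<^sup>2 = Re (cinner (P *\<^sub>V v) v)}"]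
      that eq by blast
  have "cinner (U *\<^sub>V v) (U *\<^sub>V w) = cinner (P *\<^sub>V v) w"
    if v: "v \<in> closure (cspan (range h))" and w: "w \<in> closure (cspan (range h))" for v w
  proof (rule polarization[where S = "closure (cspan (range h))" and
      F = "\<lambda>v w. cinner (U *\<^sub>V v) (U *\<^sub>V w)" and G = "\<lambda>v w. cinner (P *\<^sub>V v) w"])
    show "cinner (U *\<^sub>V u) (U *\<^sub>V u) = cinner (P *\<^sub>V u) u" if "u \<in> closure (cspan (range h))" for u
      using norm_eq[OF that] form_self[OF assms, of u] by (simp add: cinner_self)
  qed (use v w in \<open>simp_all add: cblinfun_apply_linear cinner_simps csubspace_closure_hilbert
      complex_vector.subspace_span\<close>)
  with le show thesis by (rule that)
qed

section \<open>Representations in the universal space\<close>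

lift_definition single_vector :: "'i \<Rightarrow> 'k::complex_hilbert \<Rightarrow> ('i, 'k) hilbert_sum"
  is "\<lambda>i v j. if j = i then v else 0"
proof -
  fix i :: 'i and v :: 'k
  show "(\<lambda>j. (norm (if j = i then v else 0))\<^sup>2) summable_on UNIV"
    by (rule finite_nonzero_values_imp_summable_on) (auto intro: finite_subset[of _ "{i}"])
qed

lemma norm_single_vector: "norm (single_vector i v) = norm v"
proof -
  have "(norm (single_vector i v))\<^sup>2 = (\<Sum>\<^sub>\<infinity>j\<in>{i}. (norm v)\<^sup>2)"
    unfolding norm_hilbert_sum_square
    by (rule infsum_cong_neutral) (auto simp: single_vector.rep_eq)
  then show ?thesis by (simp add: power2_eq_iff_nonneg)
qed

lift_definition single :: "'i \<Rightarrow> ('k::complex_hilbert \<Rightarrow>\<^sub>C\<^sub>L ('i, 'k) hilbert_sum)"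
  is single_vector
proof (intro conjI allI)
  fix i :: 'i
  show scaleC: "single_vector i (c *\<^sub>C v) = c *\<^sub>C single_vector i v" for c and v :: 'k
    by (rule hilbert_sum_eqI) (simp add: single_vector.rep_eq)
  show "bounded_linear (single_vector i :: 'k \<Rightarrow> _)"
    by (rule bounded_linear_intro[where K = 1])
      (auto simp: scaleR_scaleC scaleC norm_single_vector single_vector.rep_eq intro!: hilbert_sum_eqI)
qed

lemma component_single: "component (single i *\<^sub>V v) j = (if j = i then v else 0)"
  by (simp add: single.rep_eq single_vector.rep_eq)

lemma cinner_single_left: "cinner (single i *\<^sub>V v) f = cinner v (component f i)"
proof -
  have "cinner (single i *\<^sub>V v) f = (\<Sum>\<^sub>\<infinity>j\<in>{i}. cinner v (component f j))"
    unfolding cinner_hilbert_sum_def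
    by (rule infsum_cong_neutral) (auto simp: component_single)
  then show ?thesis by simp
qed

lemma adj_single: "adj (single i) *\<^sub>V f = component f i"
  by (rule cinner_right_eqI) (simp add: cinner_adj_right cinner_single_left)

lemma cinner_single_right: "cinner f (single i *\<^sub>V v) = cinner (component f i) v"
  by (simp add: cinner_adj_left[symmetric] adj_single)

lemma component_sum: "component (\<Sum>k\<in>K. f k) i = (\<Sum>k\<in>K. component (f k) i)"
  by (induction K rule: infinite_finite_induct) simp_all

lemma sum_single_component: "(\<Sum>i\<in>UNIV. single i *\<^sub>V component f (i :: 'i::finite)) = f"
  by (rule hilbert_sum_eqI) (simp add: component_sum component_single sum.delta')

lemma cblinfun_image_closure_cspan:
  assumes "csubspace S" "closed S" "\<And>v. v \<in> G \<Longrightarrow> T *\<^sub>V v \<in> S" "v \<in> closure (cspan G)"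
  shows "T *\<^sub>V v \<in> S"
proof -
  have "T *\<^sub>V v \<in> S" if "v \<in> cspan G" for v
    using that
    by (induction rule: complex_vector.span_induct_alt)
      (simp_all add: cblinfun_apply_linear complex_vector.subspace_0 complex_vector.subspace_add
        complex_vector.subspace_scale assms)
  then have "cblinfun_apply T ` closure (cspan G) \<subseteq> S"
    by (intro image_closure_subset linear_continuous_on bounded_linear_cblinfun assms) blast
  then show ?thesis using assms(4) by blast
qed

text \<open>The hull consists of all finite words in \<E> applied to \<open>F\<close>; the empty
  word gives \<open>F\<close>, and applying an operator prepends a letter.\<close>

lemma countable_invariant_hull:
  assumes "countable F" "countable \<E>"
  obtains G where "countable G" "F \<subseteq> G" "\<And>T v. T \<in> \<E> \<Longrightarrow> v \<in> G \<Longrightarrow> T *\<^sub>V v \<in> G"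
proof
  let ?G = "(\<lambda>(w, v). foldr cblinfun_apply w v) ` (lists \<E> \<times> F)"
  show "countable ?G" using assms by (intro countable_image countable_SIGMA) auto
  show "F \<subseteq> ?G" by (force intro: image_eqI[where x = "([], _)"])
  show "T *\<^sub>V v \<in> ?G" if T: "T \<in> \<E>" and v: "v \<in> ?G" for T v
  proof -
    obtain w u where "w \<in> lists \<E>" "u \<in> F" "v = foldr cblinfun_apply w u" using v by auto
    then show ?thesis using T by (intro image_eqI[where x = "(T # w, u)"]) auto
  qed
qed

text \<open>Two coordinate maps into \<open>'u ell2\<close> are combined. \<open>U\<close>, from the
  identity form, copies the separable space \<open>H\<close> isometrically onto \<open>D\<close>.
  \<open>U'\<close>, from the form of \<open>E\<close>, makes the inner product of the images of
  \<open>v\<close> at index \<open>(x', a')\<close> and \<open>w\<close> at index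
  \<open>(x, a)\<close> equal to \<open>cinner (E x x' a a' *\<^sub>V v) w\<close>. So the operators
  \<open>V a x\<close> taking \<open>U v\<close> to the image of \<open>v\<close> at index
  \<open>(x, a)\<close> factor \<open>E\<close>, the pair \<open>(D, V)\<close> is one index
  \<open>R\<close> of the universal direct sum, and \<open>J\<close> embeds \<open>H\<close> at that
  index.\<close>

lemma intertwining_isometry:
  fixes E :: "'x::finite \<Rightarrow> 'x \<Rightarrow> 'a::finite \<Rightarrow> 'a \<Rightarrow> ('h::complex_hilbert \<Rightarrow>\<^sub>C\<^sub>L 'h)"
  assumes E: "stochastic_operator_matrix E" and F: "countable F"
  obtains H :: "'h set" and J :: "'h \<Rightarrow> ('x, 'a, 'u::infinite) domain_sum"
  where "csubspace H" "F \<subseteq> H" "\<And>x x' a a' \<xi>. \<xi> \<in> H \<Longrightarrow> E x x' a a' *\<^sub>V \<xi> \<in> H"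
    and "\<And>\<xi> \<eta>. \<xi> \<in> H \<Longrightarrow> \<eta> \<in> H \<Longrightarrow> J (\<xi> + \<eta>) = J \<xi> + J \<eta>"
    and "\<And>c \<xi>. \<xi> \<in> H \<Longrightarrow> J (c *\<^sub>C \<xi>) = c *\<^sub>C J \<xi>"
    and "\<And>\<xi> \<eta>. \<xi> \<in> H \<Longrightarrow> \<eta> \<in> H \<Longrightarrow> cinner (J \<xi>) (J \<eta>) = cinner \<xi> \<eta>"
    and "\<And>x x' a a' \<xi>. \<xi> \<in> H \<Longrightarrow> e_gen x x' a a' *\<^sub>V J \<xi> = J (E x x' a a' *\<^sub>V \<xi>)"
proof -
  have "countable (range (\<lambda>(x, x', a, a'). E x x' a a'))" by (simp add: countable_finite)
  \<comment> \<open>The vector 0 is inserted to make \<open>G\<close> nonempty, as its enumeration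
    by \<open>from_nat_into\<close> requires.\<close>
  then obtain G where G: "countable G" "insert 0 F \<subseteq> G"
    and E_G: "\<And>T v. T \<in> range (\<lambda>(x, x', a, a'). E x x' a a') \<Longrightarrow> v \<in> G \<Longrightarrow> T *\<^sub>V v \<in> G"
    using countable_invariant_hull[of "insert 0 F"] F by (metis countable_insert)
  define H where "H = closure (cspan G)"
  have H: "csubspace H" "closed H"
    by (simp_all add: H_def csubspace_closure_hilbert complex_vector.subspace_span)
  have GH: "G \<subseteq> H" unfolding H_def using closure_subset complex_vector.span_superset by blast
  have E_H: "E x x' a a' *\<^sub>V \<xi> \<in> H" if "\<xi> \<in> H" for x x' a a' \<xi>
  proof (rule cblinfun_image_closure_cspan[OF H])
    show "E x x' a a' *\<^sub>V v \<in> H" if "v \<in> G" for v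
      using E_G[of "E x x' a a'" v] that GH by (force intro: image_eqI[where x = "(x, x', a, a')"])
  qed (use that in \<open>simp add: H_def\<close>)

  define E' where "E' = (\<lambda>(x, a) (x', a'). E x x' a a')"
  \<comment> \<open>The block operator of \<open>E\<close> on the direct sum of copies of the
    Hilbert space indexed by pairs \<open>(x, a)\<close>; its form is positive because the matrix
    \<open>E\<close> is.\<close>
  define P where "P = (\<Sum>i\<in>UNIV. \<Sum>j\<in>UNIV. single i o\<^sub>C E' i j o\<^sub>C adj (single j))"
  have form_P: "cinner (P *\<^sub>V f) g =
      (\<Sum>i\<in>UNIV. \<Sum>j\<in>UNIV. cinner (E' i j *\<^sub>V component f j) (component g i))"
    for f g by (simp add: P_def cinner_sum_left cinner_single_left adj_single)
  have P_pos: "cinner (P *\<^sub>V f) f \<in> \<real>\<^sub>\<ge>\<^sub>0" for f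
    using E by (simp add: form_P E'_def stochastic_operator_matrix_def positive_matrix_def)
  have form_P_single: "cinner (P *\<^sub>V single j *\<^sub>V v) (single i *\<^sub>V w) = cinner (E' i j *\<^sub>V v) w"
    for i j v w
    unfolding cinner_single_right
    by (simp add: P_def component_sum adj_single component_single sum.delta sum.delta'
        if_distrib[where f = "\<lambda>v. _ *\<^sub>V v"] cong: if_cong)

  define G' where "G' = (\<lambda>(i, v). single i *\<^sub>V v) ` ((UNIV :: ('x \<times> 'a) set) \<times> G)"
  have G': "countable G'" unfolding G'_def by (simp add: G countable_finite)
  define H' where "H' = closure (cspan G')"
  have single_H': "single i *\<^sub>V v \<in> H'" if "v \<in> H" for i v
  proof (rule cblinfun_image_closure_cspan)
    show "csubspace H'" "closed H'"
      by (simp_all add: H'_def csubspace_closure_hilbert complex_vector.subspace_span)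
    have "G' \<subseteq> H'" unfolding H'_def using closure_subset complex_vector.span_superset by blast
    then show "single i *\<^sub>V v \<in> H'" if "v \<in> G" for v using that by (auto simp: G'_def)
  qed (use that in \<open>simp add: H_def\<close>)

  have id_pos: "cinner (id_op *\<^sub>V v) v \<in> \<real>\<^sub>\<ge>\<^sub>0" for v :: 'h
    by (simp add: cinner_self complex_nonneg_Reals_iff)
  have "range (from_nat_into G) = G" "range (from_nat_into G') = G'"
    using G G' by (auto simp: G'_def intro!: range_from_nat_into)
  moreover obtain U :: "'h \<Rightarrow>\<^sub>C\<^sub>L 'u ell2"
    where U_le: "\<And>v. (norm (U *\<^sub>V v))\<^sup>2 \<le> Re (cinner (id_op *\<^sub>V v) v)"
      and U: "\<And>v w. v \<in> closure (cspan (range (from_nat_into G))) \<Longrightarrow>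
        w \<in> closure (cspan (range (from_nat_into G))) \<Longrightarrow>
        cinner (U *\<^sub>V v) (U *\<^sub>V w) = cinner (id_op *\<^sub>V v) w"
    by (rule closure_cspan_coordinates[of id_op "from_nat_into G", OF id_pos]) blast
  moreover obtain U' :: "('x \<times> 'a, 'h) hilbert_sum \<Rightarrow>\<^sub>C\<^sub>L 'u ell2"
    where U': "\<And>v w. v \<in> closure (cspan (range (from_nat_into G'))) \<Longrightarrow>
        w \<in> closure (cspan (range (from_nat_into G'))) \<Longrightarrow>
        cinner (U' *\<^sub>V v) (U' *\<^sub>V w) = cinner (P *\<^sub>V v) w"
    by (rule closure_cspan_coordinates[of P "from_nat_into G'", OF P_pos]) blast
  ultimately have U: "\<And>v w. v \<in> H \<Longrightarrow> w \<in> H \<Longrightarrow> cinner (U *\<^sub>V v) (U *\<^sub>V w) = cinner v w"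
    and U': "\<And>v w. v \<in> H' \<Longrightarrow> w \<in> H' \<Longrightarrow> cinner (U' *\<^sub>V v) (U' *\<^sub>V w) = cinner (P *\<^sub>V v) w"
    and U_le: "\<And>v. norm (U *\<^sub>V v) \<le> norm v"
    by (simp_all add: H_def H'_def cinner_self power2_le_iff_abs_le)

  have "norm (adj U) \<le> 1"
    by (rule order.trans[OF norm_adj_le]) (simp add: norm_cblinfun_leI U_le)
  then have adj_U_le: "norm (adj U *\<^sub>V \<zeta>) \<le> norm \<zeta>" for \<zeta>
    by (metis mult_right_mono mult_1 norm_cblinfun_apply_le norm_ge_zero order.trans)
  have norm_U: "norm (U *\<^sub>V v) = norm v" if "v \<in> H" for v
    using U[OF that that] unfolding cinner_self of_real_eq_iff by (simp add: power2_eq_iff_nonneg)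
  \<comment> \<open>equality in the Cauchy--Schwarz inequality\<close>
  have adj_U: "adj U *\<^sub>V U *\<^sub>V v = v" if "v \<in> H" for v
  proof -
    have "inner (adj U *\<^sub>V U *\<^sub>V v) v = (norm v)\<^sup>2"
      using U[OF that that] by (simp add: inner_eq_Re_cinner cinner_adj_left cinner_self del: of_real_power)
    moreover have "(norm (adj U *\<^sub>V U *\<^sub>V v))\<^sup>2 \<le> (norm v)\<^sup>2"
      using adj_U_le[of "U *\<^sub>V v"] norm_U[OF that] by (intro power_mono) simp_all
    ultimately have "(norm (adj U *\<^sub>V U *\<^sub>V v - v))\<^sup>2 \<le> 0"
      by (simp add: power2_norm_eq_inner inner_simps inner_commute)
    then show ?thesis by simp
  qed

  define D where "D = cblinfun_apply U ` H"
  \<comment> \<open>The operators must be defined on all of \<open>'u ell2\<close>. On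
    \<open>D\<close> the factor \<open>adj U\<close> inverts \<open>U\<close>, as shown just
    before.\<close>
  define V where "V a x = U' o\<^sub>C single (x, a) o\<^sub>C adj U" for a x
  have "csubspace D"
  proof (rule complex_vector.subspaceI)
    show "0 \<in> D" unfolding D_def using complex_vector.subspace_0[OF H(1)]
      by (metis cblinfun_apply_zero image_eqI)
    show "\<xi> + \<eta> \<in> D" if "\<xi> \<in> D" "\<eta> \<in> D" for \<xi> \<eta>
      using that complex_vector.subspace_add[OF H(1)] unfolding D_def
      by (auto simp: cblinfun_apply_add[symmetric])
    show "c *\<^sub>C \<xi> \<in> D" if "\<xi> \<in> D" for c \<xi>
      using that complex_vector.subspace_scale[OF H(1)] unfolding D_def
      by (auto simp: cblinfun_apply_scaleC[symmetric])
  qed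
  moreover have "closed D"
  proof -
    have "subspace H"
      unfolding subspace_def scaleR_scaleC using H(1)
      by (simp add: complex_vector.subspace_0 complex_vector.subspace_add complex_vector.subspace_scale)
    then have "complete D" unfolding D_def
      by (intro complete_isometric_image[of 1])
        (simp_all add: bounded_linear_cblinfun norm_U H complete_eq_closed)
    then show ?thesis by (simp add: complete_eq_closed)
  qed
  moreover have V_U: "V a x *\<^sub>V U *\<^sub>V v = U' *\<^sub>V single (x, a) *\<^sub>V v" if "v \<in> H" for a x v
    using that by (simp add: V_def adj_U)
  have V: "cinner (V a' x' *\<^sub>V U *\<^sub>V v) (V a x *\<^sub>V U *\<^sub>V w) = cinner (E x x' a a' *\<^sub>V v) w"
    if "v \<in> H" "w \<in> H" for a a' x x' v w
    using that by (simp add: V_U U' single_H' form_P_single E'_def)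
  \<comment> \<open>Through the factorization, the partial trace condition on \<open>E\<close>
    becomes the defining relation of a representation on \<open>D\<close>.\<close>
  have "(\<Sum>a\<in>UNIV. cinner (V a x' *\<^sub>V \<xi>) (V a x *\<^sub>V \<eta>)) = (if x = x' then cinner \<xi> \<eta> else 0)"
    if "\<xi> \<in> D" "\<eta> \<in> D" for x x' \<xi> \<eta>
  proof -
    obtain v w where vw: "v \<in> H" "w \<in> H" "\<xi> = U *\<^sub>V v" "\<eta> = U *\<^sub>V w"
      using \<open>\<xi> \<in> D\<close> \<open>\<eta> \<in> D\<close> unfolding D_def by blast
    have "(\<Sum>a\<in>UNIV. cinner (V a x' *\<^sub>V \<xi>) (V a x *\<^sub>V \<eta>)) = cinner ((\<Sum>a\<in>UNIV. E x x' a a) *\<^sub>V v) w"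
      using vw by (simp add: V cinner_sum_left)
    also have "\<dots> = (if x = x' then cinner v w else 0)"
      using E by (simp add: stochastic_operator_matrix_def)
    finally show ?thesis using vw by (simp add: U)
  qed
  ultimately obtain R :: "('x, 'a, 'u) representation" where R: "Rep_representation R = (D, V)"
    using Abs_representation_inverse[of "(D, V)"] by auto
  then have rep: "rep_space R = D" "rep_op R = V" by (simp_all add: rep_space_def rep_op_def)

  \<comment> \<open>For \<open>v\<close> outside \<open>H\<close> the vector
    \<open>U *\<^sub>V v\<close> need not lie in \<open>D\<close>, and then
    \<open>Domain_Sum\<close> is unspecified; hence all facts about \<open>J\<close> are confined to
    \<open>H\<close>.\<close>
  define J where "J v = (Domain_Sum (single R *\<^sub>V U *\<^sub>V v) :: ('x, 'a, 'u) domain_sum)" for v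
  have family_J: "family (J v) = single R *\<^sub>V U *\<^sub>V v" if "v \<in> H" for v
    unfolding J_def using that
    by (intro Domain_Sum_inverse)
      (auto simp: component_single rep D_def complex_vector.subspace_0[OF csubspace_rep_space])
  have gen_J: "gen a x *\<^sub>V J v = single R *\<^sub>V V a x *\<^sub>V U *\<^sub>V v" if "v \<in> H" for a x v
    using that by (intro hilbert_sum_eqI) (simp add: component_gen family_J component_single rep)
  show thesis
  proof (rule that[of H J])
    show "J (\<xi> + \<eta>) = J \<xi> + J \<eta>" if "\<xi> \<in> H" "\<eta> \<in> H" for \<xi> \<eta>
      using that complex_vector.subspace_add[OF H(1) that]
      by (simp add: family_inject[symmetric] family_J cblinfun_apply_add)
    show "J (c *\<^sub>C \<xi>) = c *\<^sub>C J \<xi>" if "\<xi> \<in> H" for c \<xi>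
      using that complex_vector.subspace_scale[OF H(1) that]
      by (simp add: family_inject[symmetric] family_J cblinfun_apply_scaleC)
    show "cinner (J \<xi>) (J \<eta>) = cinner \<xi> \<eta>" if "\<xi> \<in> H" "\<eta> \<in> H" for \<xi> \<eta>
      using that by (simp add: cinner_domain_sum_def family_J cinner_single_left component_single U)
    show "e_gen x x' a a' *\<^sub>V J \<xi> = J (E x x' a a' *\<^sub>V \<xi>)" if "\<xi> \<in> H" for x x' a a' \<xi>
    proof (rule cinner_left_eqI)
      fix g :: "('x, 'a, 'u) domain_sum"
      \<comment> \<open>The adjoint inside \<open>e_gen\<close> involves the projection onto the
        domain, so the identity is tested weakly. Only the component of \<open>g\<close> at
        \<open>R\<close> enters, and it has the form \<open>U *\<^sub>V w\<close> with
        \<open>w\<close> in \<open>H\<close>.\<close>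
      have "component (family g) R \<in> D" using family[of g] by (simp flip: rep)
      then obtain w where w: "w \<in> H" "component (family g) R = U *\<^sub>V w" by (auto simp: D_def)
      have "cinner (e_gen x x' a a' *\<^sub>V J \<xi>) g = cinner (V a' x' *\<^sub>V U *\<^sub>V \<xi>) (V a x *\<^sub>V U *\<^sub>V w)"
        using that by (simp add: e_gen_def cinner_adj_left gen_J cinner_single_left component_gen rep w)
      also have "\<dots> = cinner (U *\<^sub>V E x x' a a' *\<^sub>V \<xi>) (U *\<^sub>V w)"
        using that w E_H by (simp add: V U)
      also have "\<dots> = cinner (J (E x x' a a' *\<^sub>V \<xi>)) g"
        using that E_H by (simp add: cinner_domain_sum_def family_J cinner_single_left w)
      finally show "cinner (e_gen x x' a a' *\<^sub>V J \<xi>) g = cinner (J (E x x' a a' *\<^sub>V \<xi>)) g" .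
    qed
  qed (use H E_H G(2) GH in auto)
qed

lemmas tendsto_scaleC_cblinfun = bounded_linear.tendsto[OF bounded_linear_scaleC_cblinfun]
lemmas tendsto_adj = bounded_linear.tendsto[OF bounded_linear_adj]
lemmas tendsto_cblinfun_compose = bounded_bilinear.tendsto[OF bounded_bilinear_cblinfun_compose]

section \<open>Square roots inside closed algebras\<close>

lemma power2_norm_diff: "(norm (x - y))\<^sup>2 = (norm x)\<^sup>2 - 2 * inner x y + (norm y)\<^sup>2"
  by (simp add: power2_norm_eq_inner inner_simps inner_commute)

text \<open>Expanding the square of the norm at \<open>f\<close> gives \<open>(norm f)^2\<close>,
  minus twice \<open>(norm (V *\<^sub>V f))^2\<close>, plus the square of the norm of
  \<open>adj V *\<^sub>V V *\<^sub>V f\<close>. The last term is at most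
  \<open>(norm (V *\<^sub>V f))^2\<close>.\<close>

lemma norm_id_minus_adj_compose_le:
  assumes "norm V \<le> 1"
  shows "norm (id_op - adj V o\<^sub>C V) \<le> 1"
proof (rule norm_cblinfun_leI)
  fix f
  have "norm (adj V *\<^sub>V V *\<^sub>V f) \<le> 1 * norm (V *\<^sub>V f)"
    by (rule order.trans[OF norm_cblinfun_apply_le mult_right_mono])
      (use norm_adj_le[of V] assms in linarith, simp)
  then have "(norm (adj V *\<^sub>V V *\<^sub>V f))\<^sup>2 \<le> (norm (V *\<^sub>V f))\<^sup>2" by (intro power_mono) simp_all
  moreover have "inner f (adj V *\<^sub>V V *\<^sub>V f) = (norm (V *\<^sub>V f))\<^sup>2"
    by (simp add: inner_eq_Re_cinner cinner_adj_right cinner_self del: of_real_power)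
  ultimately have "(norm (f - adj V *\<^sub>V V *\<^sub>V f))\<^sup>2 \<le> (norm f)\<^sup>2"
    using power2_norm_diff[of f "adj V *\<^sub>V V *\<^sub>V f"] zero_le_power2[of "norm (V *\<^sub>V f)"] by linarith
  then show "norm ((id_op - adj V o\<^sub>C V) *\<^sub>V f) \<le> 1 * norm f"
    by (simp add: power2_le_iff_abs_le)
qed simp

text \<open>With \<open>A = id_op - T\<close>, a fixed point \<open>L\<close> of the map sending
  \<open>S\<close> to half of \<open>A + S o\<^sub>C S\<close> satisfies
  \<open>(id_op - L) o\<^sub>C (id_op - L) = T\<close>. The iterates from 0 are polynomials in
  \<open>A\<close>, so they are self-adjoint and stay in \<open>M\<close>. As \<open>norm A\<close>
  is at most 1, the same iteration with the number 1 in place of \<open>A\<close> controls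
  convergence.\<close>

lemma algebraic_square_root:
  fixes T :: "'h::complex_hilbert \<Rightarrow>\<^sub>C\<^sub>L 'h"
  assumes M: "csubspace M" "closed M" "\<And>S S'. S \<in> M \<Longrightarrow> S' \<in> M \<Longrightarrow> S o\<^sub>C S' \<in> M" "id_op \<in> M"
    and T: "T \<in> M" "adj T = T" "norm (id_op - T) \<le> 1"
  obtains R where "R \<in> M" "adj R = R" "R o\<^sub>C R = T"
proof -
  define A where "A = id_op - T"
  define W where "W = rec_nat 0 (\<lambda>_ S. (1/2) *\<^sub>C (A + S o\<^sub>C S))"
  define w where "w = rec_nat 0 (\<lambda>_ s. (1 + s * s) / (2 :: real))"
  have W: "W 0 = 0" "W (Suc n) = (1/2) *\<^sub>C (A + W n o\<^sub>C W n)" for n by (simp_all add: W_def)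
  have w: "w 0 = 0" "w (Suc n) = (1 + w n * w n) / 2" for n by (simp_all add: w_def)
  have w_bounds: "0 \<le> w n \<and> w n \<le> 1" for n
  proof (induction n)
    case (Suc n)
    then have "w n * w n \<le> 1" using mult_mono[of "w n" 1 "w n" 1] by simp
    then show ?case by (simp add: w)
  qed (simp add: w)
  have w_mono: "w n \<le> w (Suc n)" for n
    using sum_squares_bound[of "w n" 1] by (simp add: w power2_eq_square)
  \<comment> \<open>the scalar iteration \<open>w\<close>, which increases to 1, majorizes \<open>W\<close> and its increments\<close>
  have norm_W: "norm (W n) \<le> w n" for n
  proof (induction n)
    case (Suc n)
    have "norm (W n o\<^sub>C W n) \<le> w n * w n"
      by (rule order.trans[OF norm_cblinfun_compose_le mult_mono]) (use Suc w_bounds in auto)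
    moreover have "norm (A + W n o\<^sub>C W n) \<le> norm A + norm (W n o\<^sub>C W n)" by (rule norm_triangle_ineq)
    ultimately show ?case
      using T(3) by (simp add: W w norm_scaleC_cblinfun A_def)
  qed (simp add: W w)
  have norm_diff: "norm (W (Suc n) - W n) \<le> w (Suc n) - w n" for n
  proof (induction n)
    case 0
    show ?case
      using T(3) by (simp add: W w norm_scaleC_cblinfun A_def
        bounded_bilinear.zero_left[OF bounded_bilinear_cblinfun_compose])
  next
    case (Suc n)
    \<comment> \<open>The difference of squares is written as
      \<open>W (Suc n) o\<^sub>C ?D + ?D o\<^sub>C W n\<close>, an identity valid without
      commutation; the scalar increments obey the same formula.\<close>
    let ?D = "W (Suc n) - W n"
    have "norm (W (Suc n) o\<^sub>C ?D) \<le> w (Suc n) * (w (Suc n) - w n)"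
      by (rule order.trans[OF norm_cblinfun_compose_le mult_mono])
        (use Suc norm_W w_bounds in auto)
    moreover have "norm (?D o\<^sub>C W n) \<le> (w (Suc n) - w n) * w n"
      by (rule order.trans[OF norm_cblinfun_compose_le mult_mono])
        (use Suc norm_W w_bounds w_mono in auto)
    ultimately have "norm (W (Suc n) o\<^sub>C ?D + ?D o\<^sub>C W n)
        \<le> w (Suc n) * (w (Suc n) - w n) + (w (Suc n) - w n) * w n"
      by (rule norm_triangle_mono)
    moreover have "W (Suc (Suc n)) - W (Suc n) = (1/2) *\<^sub>C (W (Suc n) o\<^sub>C ?D + ?D o\<^sub>C W n)"
      unfolding W(2)[of "Suc n"] unfolding W(2)[of n, symmetric]
      by (subst (2) W(2)) (simp add: complex_vector.scale_right_diff_distrib[symmetric]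
        cblinfun_compose_diff_left cblinfun_compose_diff_right)
    moreover have "w (Suc (Suc n)) - w (Suc n)
        = (w (Suc n) * (w (Suc n) - w n) + (w (Suc n) - w n) * w n) / 2"
    proof -
      have "2 * w (Suc (Suc n)) = 1 + w (Suc n) * w (Suc n)" "2 * w (Suc n) = 1 + w n * w n"
        by (subst w(2), simp)+
      then have "2 * (w (Suc (Suc n)) - w (Suc n)) = w (Suc n) * (w (Suc n) - w n) + (w (Suc n) - w n) * w n"
        by algebra
      then show ?thesis by simp
    qed
    ultimately show ?case by (simp add: norm_scaleC_cblinfun)
  qed
  have le: "norm (W (n + k) - W n) \<le> w (n + k) - w n" for n k
  proof (induction k)
    case (Suc k)
    then show ?case
      using norm_diff[of "n + k"] norm_triangle_ineq[of "W (Suc (n + k)) - W (n + k)" "W (n + k) - W n"]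
      by simp
  qed simp
  have "convergent w"
    by (rule Bseq_mono_convergent) (use w_bounds w_mono in \<open>auto
      intro!: BseqI'[of _ 1] incseq_SucI simp: incseq_def[symmetric] incseq_SucD\<close>)
  then have "Cauchy w" by (rule convergent_Cauchy)
  have "Cauchy W"
  proof (rule metric_CauchyI)
    fix e :: real assume "e > 0"
    then obtain N where N: "\<And>m n. m \<ge> N \<Longrightarrow> n \<ge> N \<Longrightarrow> dist (w m) (w n) < e / 2"
      using \<open>Cauchy w\<close> unfolding Cauchy_def by (meson half_gt_zero)
    have "dist (W m) (W N) < e / 2" if "m \<ge> N" for m
    proof -
      have "dist (W m) (W N) \<le> w m - w N" using le[of N "m - N"] that by (simp add: dist_norm)
      also have "\<dots> \<le> dist (w m) (w N)" by (simp add: dist_real_def)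
      also have "\<dots> < e / 2" using N that by blast
      finally show ?thesis .
    qed
    then show "\<exists>N. \<forall>m\<ge>N. \<forall>n\<ge>N. dist (W m) (W n) < e"
      by (meson dist_triangle_half_l)
  qed
  then obtain L where L: "W \<longlonglongrightarrow> L" using Cauchy_convergent convergent_def by blast
  have "(\<lambda>n. W (Suc n)) \<longlonglongrightarrow> (1/2) *\<^sub>C (A + L o\<^sub>C L)"
    unfolding W by (intro tendsto_scaleC_cblinfun tendsto_add tendsto_cblinfun_compose L tendsto_const)
  then have "L = (1/2) *\<^sub>C (A + L o\<^sub>C L)"
    using L LIMSEQ_Suc LIMSEQ_unique by blast
  then have "2 *\<^sub>C L = A + L o\<^sub>C L"
    by (metis scaleC_scaleC scaleC_one nonzero_mult_div_cancel_left times_divide_eq_right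
        mult_1_right zero_neq_numeral)
  moreover have "2 *\<^sub>C L = L + L"
    using scaleC_add_left[of 1 1 L] by (simp add: scaleC_one)
  ultimately have root: "(id_op - L) o\<^sub>C (id_op - L) = T"
    by (simp add: cblinfun_compose_diff_left cblinfun_compose_diff_right A_def algebra_simps)
  have adj_W: "adj (W n) = W n" for n
    by (induction n) (simp_all add: W adj_scaleC adj_add adj_compose A_def adj_diff T
      bounded_linear.linear[OF bounded_linear_adj, THEN linear_0])
  have "adj L = L"
    using tendsto_adj[OF L] L unfolding adj_W by (rule LIMSEQ_unique)
  then have "adj (id_op - L) = id_op - L" by (simp add: adj_diff)
  have "W n \<in> M" for n
    by (induction n) (simp_all add: W A_def M T complex_vector.subspace_0 complex_vector.subspace_add
      complex_vector.subspace_scale complex_vector.subspace_diff)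
  then have "L \<in> M" using M(2) L closed_sequentially by blast
  then have "id_op - L \<in> M" by (simp add: M complex_vector.subspace_diff)
  then show thesis using that \<open>adj (id_op - L) = id_op - L\<close> root by blast
qed

section \<open>The algebra of the universal TRO\<close>

lemma adj_e_gen: "adj (e_gen x x' a a') = e_gen x' x a' a"
  by (simp add: e_gen_def adj_compose)

lemma infsum_finite_sum:
  fixes f :: "'i \<Rightarrow> 'j \<Rightarrow> complex"
  assumes "\<And>i. i \<in> I \<Longrightarrow> f i summable_on J"
  shows "(\<Sum>\<^sub>\<infinity>j\<in>J. \<Sum>i\<in>I. f i j) = (\<Sum>i\<in>I. \<Sum>\<^sub>\<infinity>j\<in>J. f i j)"
proof -
  have "(\<lambda>j. \<Sum>i\<in>I. f i j) summable_on J \<and> (\<Sum>\<^sub>\<infinity>j\<in>J. \<Sum>i\<in>I. f i j) = (\<Sum>i\<in>I. \<Sum>\<^sub>\<infinity>j\<in>J. f i j)"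
    using assms
    by (induction I rule: infinite_finite_induct) (simp_all add: summable_on_add infsum_add)
  then show ?thesis ..
qed

text \<open>The relation holds in every summand \<open>R\<close>; it passes to the direct sum
  because the finite sum over \<open>a\<close> can be interchanged with the sum over
  \<open>R\<close>.\<close>

lemma sum_e_gen: "(\<Sum>a\<in>UNIV. e_gen x x' a a) = (if x = x' then id_op else 0)"
proof (rule cblinfun_eqI, rule cinner_left_eqI)
  fix f g :: "('a, 'b, 'c) domain_sum"
  let ?f = "component (family f)" and ?g = "component (family g)"
  have "cinner ((\<Sum>a\<in>UNIV. e_gen x x' a a) *\<^sub>V f) g
      = (\<Sum>a\<in>UNIV. cinner (gen a x' *\<^sub>V f) (gen a x *\<^sub>V g))"
    by (simp add: e_gen_def cinner_sum_left cinner_adj_left)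
  also have "\<dots> = (\<Sum>\<^sub>\<infinity>R. \<Sum>a\<in>UNIV. cinner (component (gen a x' *\<^sub>V f) R) (component (gen a x *\<^sub>V g) R))"
    by (simp add: infsum_finite_sum cinner_summable cinner_hilbert_sum_def[of "gen _ _ *\<^sub>V _"])
  also have "\<dots> = (\<Sum>\<^sub>\<infinity>R. if x = x' then cinner (?f R) (?g R) else 0)"
    using family[of f] family[of g] by (intro infsum_cong) (simp add: component_gen rep_op_relations)
  also have "\<dots> = cinner ((if x = x' then id_op else 0) *\<^sub>V f) g"
    by (simp add: cinner_domain_sum_def cinner_hilbert_sum_def)
  finally show "cinner ((\<Sum>a\<in>UNIV. e_gen x x' a a) *\<^sub>V f) g
      = cinner ((if x = x' then id_op else 0) *\<^sub>V f) g" .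
qed

lemma closure_ternary_ring:
  assumes "s \<in> closure (ternary_ring_generated_by G)" "t \<in> closure (ternary_ring_generated_by G)"
    "u \<in> closure (ternary_ring_generated_by G)"
  shows "s o\<^sub>C adj t o\<^sub>C u \<in> closure (ternary_ring_generated_by G)"
proof -
  obtain X Y Z where "X \<longlonglongrightarrow> s" "Y \<longlonglongrightarrow> t" "Z \<longlonglongrightarrow> u"
    and "\<And>n. X n \<in> ternary_ring_generated_by G" "\<And>n. Y n \<in> ternary_ring_generated_by G"
      "\<And>n. Z n \<in> ternary_ring_generated_by G"
    using assms unfolding closure_sequential by metis
  then show ?thesis
    unfolding closure_sequential
    by (intro exI[of _ "\<lambda>n. X n o\<^sub>C adj (Y n) o\<^sub>C Z n"] conjI allI tendsto_cblinfun_compose tendsto_adj)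
      (auto intro: ternary_ring_generated_by.intros)
qed

text \<open>A product of \<open>adj s o\<^sub>C t\<close> and \<open>adj u o\<^sub>C v\<close> is
  again of this form, with second factor the ternary product of \<open>t\<close>, \<open>u\<close>,
  \<open>v\<close>. Bilinearity and continuity do the rest.\<close>

lemma right_cstar_algebra_compose:
  assumes V: "\<And>s t u. s \<in> \<V> \<Longrightarrow> t \<in> \<V> \<Longrightarrow> u \<in> \<V> \<Longrightarrow> s o\<^sub>C adj t o\<^sub>C u \<in> \<V>"
    and "S \<in> right_cstar_algebra \<V>" "T \<in> right_cstar_algebra \<V>"
  shows "S o\<^sub>C T \<in> right_cstar_algebra \<V>"
  unfolding right_cstar_algebra_def
proof (rule closure_operation[OF tendsto_cblinfun_compose _ assms(2,3)[unfolded right_cstar_algebra_def]])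
  let ?B = "{adj s o\<^sub>C t | s t. s \<in> \<V> \<and> t \<in> \<V>}"
  have B: "S o\<^sub>C T \<in> ?B" if "S \<in> ?B" "T \<in> ?B" for S T
  proof -
    obtain s t u v where "S = adj s o\<^sub>C t" "T = adj u o\<^sub>C v" "s \<in> \<V>" "t \<in> \<V>" "u \<in> \<V>" "v \<in> \<V>"
      using \<open>S \<in> ?B\<close> \<open>T \<in> ?B\<close> by blast
    moreover from this have "S o\<^sub>C T = adj s o\<^sub>C (t o\<^sub>C adj u o\<^sub>C v)" by (simp add: cblinfun_compose_assoc)
    ultimately show ?thesis using V by blast
  qed
  have B1: "S o\<^sub>C T \<in> cspan ?B" if "S \<in> ?B" "T \<in> cspan ?B" for S T
    using that(2)
  proof (induction rule: complex_vector.span_induct_alt)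
    case base
    show ?case by (simp add: bounded_bilinear.zero_right[OF bounded_bilinear_cblinfun_compose]
      complex_vector.span_zero)
  next
    case (step c X Y)
    then show ?case using B[OF that(1) step(1)]
      by (simp add: cblinfun_compose_add_right scaleC_cblinfun_compose_right
        complex_vector.span_add complex_vector.span_scale complex_vector.span_base)
  qed
  show "S o\<^sub>C T \<in> cspan ?B" if "S \<in> cspan ?B" "T \<in> cspan ?B" for S T
    using that(1)
  proof (induction rule: complex_vector.span_induct_alt)
    case base
    show ?case by (simp add: bounded_bilinear.zero_left[OF bounded_bilinear_cblinfun_compose]
      complex_vector.span_zero)
  next
    case (step c X Y)
    then show ?case using B1[OF step(1) that(2)]
      by (simp add: cblinfun_compose_add_left scaleC_cblinfun_compose_left
        complex_vector.span_add complex_vector.span_scale)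
  qed
qed

lemma csubspace_C_alg: "csubspace C_alg"
  and closed_C_alg: "closed C_alg"
  by (simp_all add: C_alg_def right_cstar_algebra_def csubspace_closure_cblinfun
    complex_vector.subspace_span)

lemma C_alg_compose: "S \<in> C_alg \<Longrightarrow> T \<in> C_alg \<Longrightarrow> S o\<^sub>C T \<in> C_alg"
  unfolding C_alg_def universal_TRO_def
  by (rule right_cstar_algebra_compose[OF closure_ternary_ring])

lemma e_gen_C_alg: "e_gen x x' a a' \<in> C_alg"
proof -
  have "gen a x \<in> universal_TRO" for a x
    unfolding universal_TRO_def
    by (rule closure_subset[THEN subsetD]) (auto intro: ternary_ring_generated_by.intros)
  then show ?thesis
    unfolding C_alg_def right_cstar_algebra_def e_gen_def
    by (intro closure_subset[THEN subsetD] complex_vector.span_base) blast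
qed

lemma T_sys_subset_C_alg: "T_sys \<subseteq> C_alg"
  unfolding T_sys_def by (rule complex_vector.span_minimal[OF _ csubspace_C_alg]) (auto simp: e_gen_C_alg)

lemma csubspace_T_sys: "csubspace T_sys"
  by (simp add: T_sys_def complex_vector.subspace_span)

lemma e_gen_T_sys: "e_gen x x' a a' \<in> T_sys"
  unfolding T_sys_def by (rule complex_vector.span_base) blast

lemma id_T_sys: "id_op \<in> T_sys"
  proof -
  have "(\<Sum>a\<in>UNIV. e_gen x x a a) \<in> T_sys" for x
    by (intro complex_vector.subspace_sum csubspace_T_sys e_gen_T_sys)
  then show ?thesis by (simp add: sum_e_gen)
qed

section \<open>The representation induced by a stochastic operator matrix\<close>

text \<open>For stochastic \<open>E\<close>, lemma \<open>norm_le_if_hom_graph\<close> shows that this is the graph of a contractive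
  homomorphism.\<close>

inductive_set hom_graph ::
    "('x::finite \<Rightarrow> 'x \<Rightarrow> 'a::finite \<Rightarrow> 'a \<Rightarrow> ('h::complex_hilbert \<Rightarrow>\<^sub>C\<^sub>L 'h)) \<Rightarrow>
      ((('x, 'a, 'u) domain_sum \<Rightarrow>\<^sub>C\<^sub>L ('x, 'a, 'u) domain_sum) \<times> ('h \<Rightarrow>\<^sub>C\<^sub>L 'h)) set"
  for E where
  gen: "(e_gen x x' a a', E x x' a a') \<in> hom_graph E"
| add: "(S, T) \<in> hom_graph E \<Longrightarrow> (S', T') \<in> hom_graph E \<Longrightarrow> (S + S', T + T') \<in> hom_graph E"
| scaleC: "(S, T) \<in> hom_graph E \<Longrightarrow> (c *\<^sub>C S, c *\<^sub>C T) \<in> hom_graph E"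
| compose: "(S, T) \<in> hom_graph E \<Longrightarrow> (S', T') \<in> hom_graph E \<Longrightarrow>
    (S o\<^sub>C S', T o\<^sub>C T') \<in> hom_graph E"

lemma hom_graph_zero: "(0, 0) \<in> hom_graph E"
  using hom_graph.scaleC[OF hom_graph.gen, of 0] by (simp add: complex_vector.scale_zero_left)

lemma hom_graph_diff:
  assumes "(S, T) \<in> hom_graph E" "(S', T') \<in> hom_graph E"
  shows "(S - S', T - T') \<in> hom_graph E"
  using hom_graph.add[OF assms(1) hom_graph.scaleC[OF assms(2), of "-1"]]
  by (simp add: complex_vector.scale_minus_left scaleC_one)

lemma hom_graph_sum:
  "(\<And>i. i \<in> I \<Longrightarrow> (S i, T i) \<in> hom_graph E) \<Longrightarrow> (\<Sum>i\<in>I. S i, \<Sum>i\<in>I. T i) \<in> hom_graph E"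
  by (induction I rule: infinite_finite_induct) (auto intro: hom_graph_zero hom_graph.add)

lemma hom_graph_id:
  fixes E :: "'x::finite \<Rightarrow> 'x \<Rightarrow> 'a::finite \<Rightarrow> 'a \<Rightarrow> ('h::complex_hilbert \<Rightarrow>\<^sub>C\<^sub>L 'h)"
  assumes "stochastic_operator_matrix E"
  shows "(id_op, id_op) \<in> hom_graph E"
proof -
  have "(\<Sum>a\<in>UNIV. e_gen x x a a, \<Sum>a\<in>UNIV. E x x a a) \<in> hom_graph E" for x
    by (intro hom_graph_sum hom_graph.gen)
  then show ?thesis using assms by (simp add: sum_e_gen stochastic_operator_matrix_def)
qed

text \<open>That \<open>T\<close> leaves \<open>H\<close> invariant is proved along with the
  intertwining: in the composition step the induction hypothesis is used at the image of \<xi> under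
  the inner factor.\<close>

lemma hom_graph_intertwines:
  assumes "(S, T) \<in> hom_graph E" "\<xi> \<in> H"
    and "\<And>x x' a a' \<xi>. \<xi> \<in> H \<Longrightarrow> E x x' a a' *\<^sub>V \<xi> \<in> H" "csubspace H"
    and "\<And>\<xi> \<eta>. \<xi> \<in> H \<Longrightarrow> \<eta> \<in> H \<Longrightarrow> J (\<xi> + \<eta>) = J \<xi> + J \<eta>"
    and "\<And>c \<xi>. \<xi> \<in> H \<Longrightarrow> J (c *\<^sub>C \<xi>) = c *\<^sub>C J \<xi>"
    and "\<And>x x' a a' \<xi>. \<xi> \<in> H \<Longrightarrow> e_gen x x' a a' *\<^sub>V J \<xi> = J (E x x' a a' *\<^sub>V \<xi>)"
  shows "T *\<^sub>V \<xi> \<in> H \<and> S *\<^sub>V J \<xi> = J (T *\<^sub>V \<xi>)"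
  using assms(1,2)
  by (induction arbitrary: \<xi> rule: hom_graph.induct)
    (simp_all add: assms(3-) complex_vector.subspace_add complex_vector.subspace_scale)

text \<open>Since \<open>H\<close> and \<open>J\<close> change with \<open>F\<close>, only
  consequences for vectors of \<open>F\<close> are exported; they cover every pair of the graph at
  once.\<close>

lemma stochastic_dilation:
  fixes E :: "'x::finite \<Rightarrow> 'x \<Rightarrow> 'a::finite \<Rightarrow> 'a \<Rightarrow> ('h::complex_hilbert \<Rightarrow>\<^sub>C\<^sub>L 'h)"
  assumes "stochastic_operator_matrix E" "countable F"
  obtains J :: "'h \<Rightarrow> ('x, 'a, 'u::infinite) domain_sum"
  where "\<And>S T \<xi> \<eta>. (S, T) \<in> hom_graph E \<Longrightarrow> \<xi> \<in> F \<Longrightarrow> \<eta> \<in> F \<Longrightarrow>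
      cinner (S *\<^sub>V J \<xi>) (J \<eta>) = cinner (T *\<^sub>V \<xi>) \<eta>"
    and "\<And>S T \<xi>. (S, T) \<in> hom_graph E \<Longrightarrow> \<xi> \<in> F \<Longrightarrow> norm (S *\<^sub>V J \<xi>) = norm (T *\<^sub>V \<xi>)"
    and "\<And>\<xi>. \<xi> \<in> F \<Longrightarrow> norm (J \<xi>) = norm \<xi>"
proof -
  obtain H :: "'h set" and J :: "'h \<Rightarrow> ('x, 'a, 'u) domain_sum"
    where H: "csubspace H" "F \<subseteq> H" "\<And>x x' a a' \<xi>. \<xi> \<in> H \<Longrightarrow> E x x' a a' *\<^sub>V \<xi> \<in> H"
      and J: "\<And>\<xi> \<eta>. \<xi> \<in> H \<Longrightarrow> \<eta> \<in> H \<Longrightarrow> J (\<xi> + \<eta>) = J \<xi> + J \<eta>"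
        "\<And>c \<xi>. \<xi> \<in> H \<Longrightarrow> J (c *\<^sub>C \<xi>) = c *\<^sub>C J \<xi>"
      and iso: "\<And>\<xi> \<eta>. \<xi> \<in> H \<Longrightarrow> \<eta> \<in> H \<Longrightarrow> cinner (J \<xi>) (J \<eta>) = cinner \<xi> \<eta>"
      and e_gen: "\<And>x x' a a' \<xi>. \<xi> \<in> H \<Longrightarrow> e_gen x x' a a' *\<^sub>V J \<xi> = J (E x x' a a' *\<^sub>V \<xi>)"
    by (rule intertwining_isometry[OF assms]) blast
  have graph: "T *\<^sub>V \<xi> \<in> H \<and> S *\<^sub>V J \<xi> = J (T *\<^sub>V \<xi>)" if "(S, T) \<in> hom_graph E" "\<xi> \<in> H" for S T \<xi>
    by (rule hom_graph_intertwines[OF that H(3) H(1) J e_gen])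
  have norm: "norm (J \<xi>) = norm \<xi>" if "\<xi> \<in> H" for \<xi>
    using iso[OF that that] unfolding cinner_self of_real_eq_iff by (simp add: power2_eq_iff_nonneg)
  show thesis
    by (rule that[of J]) (use H(2) graph norm iso in \<open>auto simp: subset_iff\<close>)
qed

text \<open>An operator norm is tested one vector at a time, so the dilation may be chosen anew for
  each \<xi>.\<close>

lemma norm_le_if_hom_graph:
  fixes S :: "('x::finite, 'a::finite, 'u::infinite) domain_sum \<Rightarrow>\<^sub>C\<^sub>L ('x, 'a, 'u) domain_sum"
  assumes "stochastic_operator_matrix E" "(S, T) \<in> hom_graph E"
  shows "norm T \<le> norm S"
proof (rule norm_cblinfun_leI)
  fix \<xi>
  obtain J :: "_ \<Rightarrow> ('x, 'a, 'u) domain_sum"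
    where "norm (S *\<^sub>V J \<xi>) = norm (T *\<^sub>V \<xi>)" "norm (J \<xi>) = norm \<xi>"
    using stochastic_dilation[OF assms(1), of "{\<xi>}"] assms(2)
    by (metis countable_empty countable_insert singletonI)
  then show "norm (T *\<^sub>V \<xi>) \<le> norm S * norm \<xi>"
    using norm_cblinfun_apply_le[of S "J \<xi>"] by simp
qed simp

text \<open>The symmetry of \<open>e_gen\<close> is transported by a dilation that contains both
  test vectors. The claim does not mention the universe, and \<open>nat\<close> serves as
  one.\<close>

lemma stochastic_adj:
  fixes E :: "'x::finite \<Rightarrow> 'x \<Rightarrow> 'a::finite \<Rightarrow> 'a \<Rightarrow> ('h::complex_hilbert \<Rightarrow>\<^sub>C\<^sub>L 'h)"
  assumes "stochastic_operator_matrix E"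
  shows "adj (E x x' a a') = E x' x a' a"
proof (rule adj_eqI)
  fix \<xi> \<eta>
  obtain J :: "'h \<Rightarrow> ('x, 'a, nat) domain_sum"
    where J: "\<And>S T u v. (S, T) \<in> hom_graph E \<Longrightarrow> u \<in> {\<xi>, \<eta>} \<Longrightarrow> v \<in> {\<xi>, \<eta>} \<Longrightarrow>
      cinner (S *\<^sub>V J u) (J v) = cinner (T *\<^sub>V u) v"
    by (rule stochastic_dilation[OF assms, of "{\<xi>, \<eta>}"]) auto
  have "cinner (E x x' a a' *\<^sub>V \<xi>) \<eta> = cinner (e_gen x x' a a' *\<^sub>V J \<xi>) (J \<eta>)"
    using J[OF hom_graph.gen] by simp
  also have "\<dots> = cinner (J \<xi>) (e_gen x' x a' a *\<^sub>V J \<eta>)"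
    unfolding adj_e_gen[of x x' a a', symmetric] cinner_adj_right ..
  also have "\<dots> = cnj (cinner (E x' x a' a *\<^sub>V \<eta>) \<xi>)"
    using J[OF hom_graph.gen] by (subst cinner_commute) simp
  also have "\<dots> = cinner \<xi> (E x' x a' a *\<^sub>V \<eta>)" by (rule cinner_commute[symmetric])
  finally show "cinner (E x x' a a' *\<^sub>V \<xi>) \<eta> = cinner \<xi> (E x' x a' a *\<^sub>V \<eta>)" .
qed

lemma hom_graph_adj:
  assumes "stochastic_operator_matrix E" "(S, T) \<in> hom_graph E"
  shows "(adj S, adj T) \<in> hom_graph E"
  using assms(2)
  by (induction rule: hom_graph.induct)
    (simp_all add: adj_e_gen stochastic_adj[OF assms(1)] adj_add adj_scaleC adj_compose hom_graph.intros)

text \<open>This reduces \<open>C_alg\<close>, defined through the closed ternary ring, to the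
  algebra generated by the \<open>e_gen\<close>. What must be shown is that
  \<open>adj s o\<^sub>C t\<close> lies in \<open>A\<close> for all \<open>s\<close>,
  \<open>t\<close> of the ternary ring.\<close>

lemma C_alg_subset_closure:
  assumes e_gen: "\<And>x x' a a'. e_gen x x' a a' \<in> A" and A: "csubspace A"
    and compose: "\<And>S T. S \<in> A \<Longrightarrow> T \<in> A \<Longrightarrow> S o\<^sub>C T \<in> A"
    and adj: "\<And>S. S \<in> A \<Longrightarrow> adj S \<in> A"
  shows "C_alg \<subseteq> closure A"
proof -
  let ?R = "ternary_ring_generated_by {gen a x | a x. True}"
  \<comment> \<open>The generators are not elements of \<open>A\<close>, only their products with
    adjoints of generators are. The second conjunct quantifies over all \<open>r\<close> that behave
    like \<open>t\<close> on the right, so that one induction on \<open>s\<close> handles both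
    arguments.\<close>
  have ternary: "(\<forall>a x. adj (gen a x) o\<^sub>C s \<in> A) \<and>
      (\<forall>r. (\<forall>a x. adj (gen a x) o\<^sub>C r \<in> A) \<longrightarrow> adj s o\<^sub>C r \<in> A)" if "s \<in> ?R" for s
    using that
  proof induction
    case (1 g)
    then show ?case using e_gen by (auto simp: e_gen_def)
  next
    case (2 s t)
    then show ?case
      by (simp add: cblinfun_compose_add_left cblinfun_compose_add_right adj_add
        complex_vector.subspace_add[OF A])
  next
    case (3 s c)
    then show ?case
      by (simp add: scaleC_cblinfun_compose_left scaleC_cblinfun_compose_right adj_scaleC
        complex_vector.subspace_scale[OF A])
  next
    case (4 s t u)
    \<comment> \<open>Regroup into two factors, each in \<open>A\<close>:
      \<open>adj t o\<^sub>C u\<close> here and \<open>adj u o\<^sub>C t\<close> below are instances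
      of the second conjunct, applied to elements that satisfy the first.\<close>
    have "adj (gen a x) o\<^sub>C (s o\<^sub>C adj t o\<^sub>C u) \<in> A" for a x
      using compose[of "adj (gen a x) o\<^sub>C s" "adj t o\<^sub>C u"] 4 by (simp add: cblinfun_compose_assoc)
    moreover have "adj (s o\<^sub>C adj t o\<^sub>C u) o\<^sub>C r \<in> A" if "\<forall>a x. adj (gen a x) o\<^sub>C r \<in> A" for r
      using compose[of "adj u o\<^sub>C t" "adj s o\<^sub>C r"] 4 that
      by (simp add: cblinfun_compose_assoc adj_compose)
    ultimately show ?case by blast
  qed
  have "adj s o\<^sub>C t \<in> closure A" if "s \<in> closure ?R" "t \<in> closure ?R" for s t
    by (rule closure_operation[of "\<lambda>s t. adj s o\<^sub>C t", OF tendsto_cblinfun_compose[OF tendsto_adj] _ that])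
      (use ternary in auto)
  then have "cspan {adj s o\<^sub>C t | s t. s \<in> closure ?R \<and> t \<in> closure ?R} \<subseteq> closure A"
    by (intro complex_vector.span_minimal csubspace_closure_cblinfun A) auto
  then show ?thesis
    unfolding C_alg_def universal_TRO_def right_cstar_algebra_def by (rule closure_minimal) simp
qed

section \<open>The closure of the graph as a *-homomorphism on \<open>C_alg\<close>\<close>

lemma closure_hom_graph_scaleC:
  assumes "(S, T) \<in> closure (hom_graph E)"
  shows "(c *\<^sub>C S, c *\<^sub>C T) \<in> closure (hom_graph E)"
  by (rule closure_operation[of "\<lambda>p _. (c *\<^sub>C fst p, c *\<^sub>C snd p)", OF _ _ assms assms,
      simplified fst_conv snd_conv])
    ((rule tendsto_Pair tendsto_fst tendsto_snd tendsto_scaleC_cblinfun | assumption)+,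
      auto intro: hom_graph.scaleC)

lemma closure_hom_graph_adj:
  assumes "stochastic_operator_matrix E" "(S, T) \<in> closure (hom_graph E)"
  shows "(adj S, adj T) \<in> closure (hom_graph E)"
  by (rule closure_operation[of "\<lambda>p _. (adj (fst p), adj (snd p))", OF _ _ assms(2) assms(2),
      simplified fst_conv snd_conv])
    ((rule tendsto_Pair tendsto_fst tendsto_snd tendsto_adj | assumption)+,
      auto intro: hom_graph_adj[OF assms(1)])

text \<open>The contraction estimate is a closed condition on pairs, so it holds on the closure.
  Applied to the difference of two pairs it gives uniqueness.\<close>

lemma closure_hom_graph:
  fixes E :: "'x::finite \<Rightarrow> 'x \<Rightarrow> 'a::finite \<Rightarrow> 'a \<Rightarrow> ('h::complex_hilbert \<Rightarrow>\<^sub>C\<^sub>L 'h)"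
    and S S' :: "('x, 'a, 'u::infinite) domain_sum \<Rightarrow>\<^sub>C\<^sub>L ('x, 'a, 'u) domain_sum"
  assumes E: "stochastic_operator_matrix E"
    and ST: "(S, T) \<in> closure (hom_graph E)" and ST': "(S', T') \<in> closure (hom_graph E)"
  shows closure_hom_graph_add: "(S + S', T + T') \<in> closure (hom_graph E)"
    and closure_hom_graph_compose: "(S o\<^sub>C S', T o\<^sub>C T') \<in> closure (hom_graph E)"
    and closure_hom_graph_unique: "S = S' \<Longrightarrow> T = T'"
proof -
  note tendsto = tendsto_Pair tendsto_fst tendsto_snd
  let ?G = "hom_graph E :: ((('x, 'a, 'u) domain_sum \<Rightarrow>\<^sub>C\<^sub>L ('x, 'a, 'u) domain_sum) \<times> _) set"
  have op: "f (S, T) (S', T') \<in> closure ?G"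
    if "\<And>X Y x y. X \<longlonglongrightarrow> x \<Longrightarrow> Y \<longlonglongrightarrow> y \<Longrightarrow> (\<lambda>n. f (X n) (Y n)) \<longlonglongrightarrow> f x y"
      and "\<And>p q. p \<in> ?G \<Longrightarrow> q \<in> ?G \<Longrightarrow> f p q \<in> ?G" for f
    by (rule closure_operation[OF that ST ST'])
  show "(S + S', T + T') \<in> closure ?G"
    by (rule op[of "\<lambda>p q. (fst p + fst q, snd p + snd q)", simplified fst_conv snd_conv])
      ((rule tendsto tendsto_add | assumption)+, auto intro: hom_graph.add)
  show "(S o\<^sub>C S', T o\<^sub>C T') \<in> closure ?G"
    by (rule op[of "\<lambda>p q. (fst p o\<^sub>C fst q, snd p o\<^sub>C snd q)", simplified fst_conv snd_conv])
      ((rule tendsto tendsto_cblinfun_compose | assumption)+, auto intro: hom_graph.compose)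
  have "(S - S', T - T') \<in> closure ?G"
    by (rule op[of "\<lambda>p q. (fst p - fst q, snd p - snd q)", simplified fst_conv snd_conv])
      ((rule tendsto tendsto_diff | assumption)+, auto intro: hom_graph_diff)
  moreover have "closure ?G \<subseteq> {p. norm (snd p) \<le> norm (fst p)}"
    using norm_le_if_hom_graph[OF E]
    by (intro closure_minimal closed_Collect_le continuous_intros) auto
  ultimately have "norm (T - T') \<le> norm (S - S')" by auto
  then show "T = T'" if "S = S'" using that by simp
qed

text \<open>Approximate \<open>S\<close> from the domain of the graph; by the contraction estimate
  the partners of the approximants form a Cauchy sequence, whose limit is the partner of
  \<open>S\<close>.\<close>

lemma C_alg_subset_fst_closure_hom_graph:
  fixes E :: "'x::finite \<Rightarrow> 'x \<Rightarrow> 'a::finite \<Rightarrow> 'a \<Rightarrow> ('h::complex_hilbert \<Rightarrow>\<^sub>C\<^sub>L 'h)"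
    and S :: "('x, 'a, 'u::infinite) domain_sum \<Rightarrow>\<^sub>C\<^sub>L ('x, 'a, 'u) domain_sum"
  assumes E: "stochastic_operator_matrix E" and S: "S \<in> C_alg"
  shows "\<exists>T. (S, T) \<in> closure (hom_graph E)"
proof -
  let ?A = "Domain (hom_graph E :: ((('x, 'a, 'u) domain_sum \<Rightarrow>\<^sub>C\<^sub>L ('x, 'a, 'u) domain_sum) \<times> _) set)"
  have "C_alg \<subseteq> closure ?A"
  proof (rule C_alg_subset_closure)
    show "csubspace ?A"
      by (rule complex_vector.subspaceI)
        (blast intro: hom_graph_zero hom_graph.add hom_graph.scaleC)+
    show "e_gen x x' a a' \<in> ?A" for x x' a a' by (blast intro: hom_graph.gen)
    show "S o\<^sub>C T \<in> ?A" if "S \<in> ?A" "T \<in> ?A" for S T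
      using that by (blast intro: hom_graph.compose)
    show "adj S \<in> ?A" if "S \<in> ?A" for S
      using that by (blast intro: hom_graph_adj[OF E])
  qed
  then obtain X where X: "\<And>n. X n \<in> ?A" "X \<longlonglongrightarrow> S" using S closure_sequential by blast
  then have "\<forall>n. \<exists>T. (X n, T) \<in> hom_graph E" by blast
  then obtain Y where Y: "\<And>n. (X n, Y n) \<in> hom_graph E" by metis
  have "dist (Y m) (Y n) \<le> dist (X m) (X n)" for m n
    using norm_le_if_hom_graph[OF E hom_graph_diff[OF Y Y]] by (simp add: dist_norm)
  then have "Cauchy Y"
    using LIMSEQ_imp_Cauchy[OF X(2)] unfolding Cauchy_def by (meson order_le_less_trans)
  then obtain T where "Y \<longlonglongrightarrow> T" using Cauchy_convergent convergent_def by blast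
  then have "(S, T) \<in> closure (hom_graph E)"
    unfolding closure_sequential using X(2) Y
    by (intro exI[of _ "\<lambda>n. (X n, Y n)"]) (auto intro: tendsto_Pair)
  then show ?thesis ..
qed

lemma stochastic_representation:
  fixes E :: "'x::finite \<Rightarrow> 'x \<Rightarrow> 'a::finite \<Rightarrow> 'a \<Rightarrow> ('h::complex_hilbert \<Rightarrow>\<^sub>C\<^sub>L 'h)"
  assumes E: "stochastic_operator_matrix E"
  obtains \<pi> :: "(('x, 'a, 'u::infinite) domain_sum \<Rightarrow>\<^sub>C\<^sub>L ('x, 'a, 'u) domain_sum) \<Rightarrow> ('h \<Rightarrow>\<^sub>C\<^sub>L 'h)"
  where "unital_star_rep_on C_alg \<pi>" "\<And>S T. (S, T) \<in> hom_graph E \<Longrightarrow> \<pi> S = T"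
proof -
  define \<pi> :: "(('x, 'a, 'u) domain_sum \<Rightarrow>\<^sub>C\<^sub>L ('x, 'a, 'u) domain_sum) \<Rightarrow> ('h \<Rightarrow>\<^sub>C\<^sub>L 'h)"
    where "\<pi> S = (THE T. (S, T) \<in> closure (hom_graph E))" for S
  have \<pi>_eq: "\<pi> S = T" if "(S, T) \<in> closure (hom_graph E)" for S T
    unfolding \<pi>_def by (rule the_equality) (use that closure_hom_graph_unique[OF E] in blast)+
  have \<pi>: "(S, \<pi> S) \<in> closure (hom_graph E)" if "S \<in> C_alg" for S
    using C_alg_subset_fst_closure_hom_graph[OF E that] \<pi>_eq by metis
  have graph: "\<pi> S = T" if "(S, T) \<in> hom_graph E" for S T
    using that closure_subset by (intro \<pi>_eq) blast
  have "unital_star_rep_on C_alg \<pi>"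
    unfolding unital_star_rep_on_def clinear_on_def
  proof (intro conjI ballI allI)
    fix S T :: "('x, 'a, 'u) domain_sum \<Rightarrow>\<^sub>C\<^sub>L ('x, 'a, 'u) domain_sum" and c :: complex
    assume S: "S \<in> C_alg"
    note S = S \<pi>[OF S]
    show "\<pi> (c *\<^sub>C S) = c *\<^sub>C \<pi> S" by (intro \<pi>_eq closure_hom_graph_scaleC[OF S(2)])
    show "\<pi> (adj S) = adj (\<pi> S)" by (intro \<pi>_eq closure_hom_graph_adj[OF E S(2)])
    assume "T \<in> C_alg"
    note T = \<pi>[OF this]
    show "\<pi> (S + T) = \<pi> S + \<pi> T" by (intro \<pi>_eq closure_hom_graph_add[OF E S(2) T])
    show "\<pi> (S o\<^sub>C T) = \<pi> S o\<^sub>C \<pi> T" by (intro \<pi>_eq closure_hom_graph_compose[OF E S(2) T])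
  qed (rule graph[OF hom_graph_id[OF E]])
  then show thesis using graph by (rule that)
qed

section \<open>Equivalence of the three conditions\<close>

lemma clinear_on_zero: "csubspace S \<Longrightarrow> clinear_on S \<phi> \<Longrightarrow> \<phi> 0 = 0"
  unfolding clinear_on_def
  by (metis complex_vector.scale_zero_left complex_vector.subspace_0)

lemma clinear_on_sum:
  assumes "csubspace S" "clinear_on S \<phi>" "\<And>i. i \<in> I \<Longrightarrow> f i \<in> S"
  shows "\<phi> (\<Sum>i\<in>I. f i) = (\<Sum>i\<in>I. \<phi> (f i))"
  using assms(3)
proof (induction I rule: infinite_finite_induct)
  case (insert i I)
  then have "\<phi> (f i + (\<Sum>i\<in>I. f i)) = \<phi> (f i) + \<phi> (\<Sum>i\<in>I. f i)"
    using assms(1,2) unfolding clinear_on_def by (simp add: complex_vector.subspace_sum)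
  then show ?case using insert by simp
qed (use clinear_on_zero[OF assms(1,2)] in simp_all)

text \<open>Connects a linear \<phi> with the graph of its own matrix. It shows that \<phi> agrees
  with the representation built from that matrix, and that two linear maps with the same matrix
  coincide on \<open>T_sys\<close>.\<close>

lemma T_sys_hom_graph:
  assumes "clinear_on T_sys \<phi>" "t \<in> T_sys"
  shows "(t, \<phi> t) \<in> hom_graph (\<lambda>x x' a a'. \<phi> (e_gen x x' a a'))"
proof -
  \<comment> \<open>Membership in \<open>T_sys\<close> is carried through the induction because
    \<phi> is linear only there.\<close>
  have "t \<in> T_sys \<and> (t, \<phi> t) \<in> hom_graph (\<lambda>x x' a a'. \<phi> (e_gen x x' a a'))"
    using assms(2) unfolding T_sys_def
  proof (induction rule: complex_vector.span_induct_alt)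
    case base
    show ?case using clinear_on_zero[OF csubspace_T_sys assms(1)] hom_graph_zero
      by (simp add: complex_vector.span_zero)
  next
    case (step c s t)
    then obtain x x' a a' where s: "s = e_gen x x' a a'" by blast
    have st: "s \<in> T_sys" "t \<in> T_sys"
      using s step(2) unfolding T_sys_def[symmetric] by (simp_all add: e_gen_T_sys)
    then have "\<phi> (c *\<^sub>C s + t) = c *\<^sub>C \<phi> s + \<phi> t"
      using assms(1) unfolding clinear_on_def
      by (simp add: complex_vector.subspace_scale[OF csubspace_T_sys])
    then show ?case
      unfolding T_sys_def[symmetric]
      using hom_graph.add[OF hom_graph.scaleC[OF hom_graph.gen] step(2)[THEN conjunct2]] s st
      by (simp add: complex_vector.subspace_add[OF csubspace_T_sys]
        complex_vector.subspace_scale[OF csubspace_T_sys])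
  qed
  then show ?thesis ..
qed

lemma stochastic_sum:
  assumes "csubspace S" "clinear_on S \<phi>" "T_sys \<subseteq> S" "\<phi> id_op = id_op"
  shows "(\<Sum>a\<in>UNIV. \<phi> (e_gen x x' a a)) = (if x = x' then id_op else 0)"
proof -
  have "(\<Sum>a\<in>UNIV. \<phi> (e_gen x x' a a)) = \<phi> (\<Sum>a\<in>UNIV. e_gen x x' a a)"
    by (intro clinear_on_sum[OF assms(1,2), symmetric] subsetD[OF assms(3)] e_gen_T_sys)
  then show ?thesis using assms clinear_on_zero by (auto simp: sum_e_gen)
qed

text \<open>The quadratic form at \<xi> is the sum over \<open>k\<close> of the squared norms of the
  vectors obtained by summing \<open>V k j *\<^sub>V \<xi> j\<close> over \<open>j\<close>.\<close>

lemma positive_matrix_gram: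
  "positive_matrix I (\<lambda>i j. \<Sum>k\<in>K. adj (V k i) o\<^sub>C V k j)"
  unfolding positive_matrix_def
proof
  fix \<xi>
  have "(\<Sum>i\<in>I. \<Sum>j\<in>I. cinner ((\<Sum>k\<in>K. adj (V k i) o\<^sub>C V k j) *\<^sub>V \<xi> j) (\<xi> i))
      = (\<Sum>i\<in>I. \<Sum>j\<in>I. \<Sum>k\<in>K. cinner (V k j *\<^sub>V \<xi> j) (V k i *\<^sub>V \<xi> i))"
    by (simp add: cinner_sum_left cinner_adj_left)
  also have "\<dots> = (\<Sum>k\<in>K. \<Sum>i\<in>I. \<Sum>j\<in>I. cinner (V k j *\<^sub>V \<xi> j) (V k i *\<^sub>V \<xi> i))"
    by (subst (2) sum.swap, subst sum.swap) (rule refl)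
  also have "\<dots> = (\<Sum>k\<in>K. cinner (\<Sum>j\<in>I. V k j *\<^sub>V \<xi> j) (\<Sum>i\<in>I. V k i *\<^sub>V \<xi> i))"
    by (simp add: cinner_sum_left cinner_sum_right)
  also have "\<dots> = complex_of_real (\<Sum>k\<in>K. (norm (\<Sum>j\<in>I. V k j *\<^sub>V \<xi> j))\<^sup>2)"
    by (simp add: cinner_self)
  finally show "(\<Sum>i\<in>I. \<Sum>j\<in>I. cinner ((\<Sum>k\<in>K. adj (V k i) o\<^sub>C V k j) *\<^sub>V \<xi> j) (\<xi> i)) \<in> \<real>\<^sub>\<ge>\<^sub>0"
    by (simp only: nonneg_Reals_of_real_iff) (simp add: sum_nonneg)
qed

text \<open>The \<open>e_gen\<close> form the Gram matrix of one row of generators, so their matrix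
  is positive with entries in \<open>T_sys\<close>, and complete positivity passes this on to
  \<phi>.\<close>

lemma ucp_imp_stochastic:
  fixes \<phi> :: "(('x::finite, 'a::finite, 'u) domain_sum \<Rightarrow>\<^sub>C\<^sub>L ('x, 'a, 'u) domain_sum) \<Rightarrow>
    ('h::complex_hilbert \<Rightarrow>\<^sub>C\<^sub>L 'h)"
  assumes \<phi>: "ucp_on T_sys \<phi>"
  shows "stochastic_operator_matrix (\<lambda>x x' a a'. \<phi> (e_gen x x' a a'))"
proof -
  let ?e = "\<lambda>(x, a) (x', a'). e_gen x x' a a' :: ('x, 'a, 'u) domain_sum \<Rightarrow>\<^sub>C\<^sub>L ('x, 'a, 'u) domain_sum"
  \<comment> \<open>Complete positivity speaks of matrices indexed by \<open>{..<n}\<close>; this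
    bijection renumbers the pairs \<open>(x, a)\<close>.\<close>
  obtain g :: "nat \<Rightarrow> 'x \<times> 'a" where g: "bij_betw g {..<CARD('x \<times> 'a)} UNIV"
    using ex_bij_betw_nat_finite[of "UNIV :: ('x \<times> 'a) set"] by (auto simp: atLeast0LessThan)
  let ?n = "CARD('x \<times> 'a)"
  have "positive_matrix {..<?n} (\<lambda>i j. ?e (g i) (g j))"
    using positive_matrix_gram[where K = "{()}" and V = "\<lambda>_ i. gen (snd (g i)) (fst (g i))"]
    by (simp add: e_gen_def split_beta)
  moreover have "?e (g i) (g j) \<in> T_sys" for i j by (simp add: split_beta e_gen_T_sys)
  ultimately have pos: "positive_matrix {..<?n} (\<lambda>i j. \<phi> (?e (g i) (g j)))"
    using \<phi>[unfolded ucp_on_def completely_positive_on_def, THEN conjunct2, THEN conjunct2,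
        rule_format, of ?n "\<lambda>i j. ?e (g i) (g j)"] by blast
  have "positive_matrix UNIV (\<lambda>i j. \<phi> (?e i j))"
    unfolding positive_matrix_def
  proof
    fix \<xi> :: "'x \<times> 'a \<Rightarrow> 'h"
    have "(\<Sum>i\<in>UNIV. \<Sum>j\<in>UNIV. cinner (\<phi> (?e i j) *\<^sub>V \<xi> j) (\<xi> i))
      = (\<Sum>i<?n. \<Sum>j<?n. cinner (\<phi> (?e (g i) (g j)) *\<^sub>V \<xi> (g j)) (\<xi> (g i)))"
      by (simp only: sum.reindex_bij_betw[OF g, symmetric])
    then show "(\<Sum>i\<in>UNIV. \<Sum>j\<in>UNIV. cinner (\<phi> (?e i j) *\<^sub>V \<xi> j) (\<xi> i)) \<in> \<real>\<^sub>\<ge>\<^sub>0"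
      using pos[unfolded positive_matrix_def, rule_format, of "\<lambda>i. \<xi> (g i)"] by simp
  qed
  moreover have "(\<lambda>i j. \<phi> (?e i j)) = (\<lambda>(x, a) (x', a'). \<phi> (e_gen x x' a a'))"
    by (auto simp: fun_eq_iff)
  ultimately have "positive_matrix UNIV (\<lambda>(x, a) (x', a'). \<phi> (e_gen x x' a a'))" by simp
  then show ?thesis
    using \<phi> stochastic_sum[OF csubspace_T_sys, of \<phi>]
    unfolding stochastic_operator_matrix_def ucp_on_def by simp
qed

text \<open>By a dilation over the countable set \<open>range \<xi>\<close>, the quadratic form of
  the matrix of images at \<xi> equals that of the original matrix at the vectors
  \<open>J (\<xi> i)\<close>.\<close>

lemma stochastic_imp_ucp:
  fixes \<phi> :: "(('x::finite, 'a::finite, 'u::infinite) domain_sum \<Rightarrow>\<^sub>C\<^sub>L ('x, 'a, 'u) domain_sum) \<Rightarrow>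
    ('h::complex_hilbert \<Rightarrow>\<^sub>C\<^sub>L 'h)"
  assumes \<phi>: "clinear_on T_sys \<phi>"
    and E: "stochastic_operator_matrix (\<lambda>x x' a a'. \<phi> (e_gen x x' a a'))"
  shows "ucp_on T_sys \<phi>"
  unfolding ucp_on_def
proof (intro conjI \<phi>)
  have "\<phi> (\<Sum>a\<in>UNIV. e_gen x x a a) = (\<Sum>a\<in>UNIV. \<phi> (e_gen x x a a))" for x
    by (intro clinear_on_sum[OF csubspace_T_sys \<phi>] e_gen_T_sys)
  then show "\<phi> id_op = id_op"
    using E by (simp add: sum_e_gen stochastic_operator_matrix_def)
  show "completely_positive_on T_sys \<phi>"
    unfolding completely_positive_on_def
  proof (intro allI impI, elim conjE)
    fix n and T :: "nat \<Rightarrow> nat \<Rightarrow> (('x, 'a, 'u) domain_sum \<Rightarrow>\<^sub>C\<^sub>L ('x, 'a, 'u) domain_sum)"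
    assume T: "\<forall>i<n. \<forall>j<n. T i j \<in> T_sys" "positive_matrix {..<n} T"
    show "positive_matrix {..<n} (\<lambda>i j. \<phi> (T i j))"
      unfolding positive_matrix_def
    proof
      fix \<xi> :: "nat \<Rightarrow> 'h"
      obtain J :: "'h \<Rightarrow> ('x, 'a, 'u) domain_sum"
        where J: "\<And>S T \<zeta> \<eta>. (S, T) \<in> hom_graph (\<lambda>x x' a a'. \<phi> (e_gen x x' a a')) \<Longrightarrow>
          \<zeta> \<in> range \<xi> \<Longrightarrow> \<eta> \<in> range \<xi> \<Longrightarrow> cinner (S *\<^sub>V J \<zeta>) (J \<eta>) = cinner (T *\<^sub>V \<zeta>) \<eta>"
        by (rule stochastic_dilation[OF E, of "range \<xi>"]) auto
      have "(\<Sum>i<n. \<Sum>j<n. cinner (\<phi> (T i j) *\<^sub>V \<xi> j) (\<xi> i))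
          = (\<Sum>i<n. \<Sum>j<n. cinner (T i j *\<^sub>V J (\<xi> j)) (J (\<xi> i)))"
        using T(1) by (intro sum.cong refl J[symmetric] T_sys_hom_graph[OF \<phi>]) auto
      then show "(\<Sum>i<n. \<Sum>j<n. cinner (\<phi> (T i j) *\<^sub>V \<xi> j) (\<xi> i)) \<in> \<real>\<^sub>\<ge>\<^sub>0"
        using T(2)[unfolded positive_matrix_def, rule_format, of "\<lambda>i. J (\<xi> i)"] by simp
    qed
  qed
qed

text \<open>The operator \<open>adj V o\<^sub>C V\<close>, with \<open>V\<close> the row of all
  \<open>gen\<close>, has the \<open>e_gen\<close> as entries. Its square root, taken inside the
  matrices over \<open>C_alg\<close>, replaces \<open>V\<close> by a factor whose entries lie in
  \<open>C_alg\<close>.\<close>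

lemma e_gen_square_root:
  obtains r :: "'x::finite \<times> 'a::finite \<Rightarrow> 'x \<times> 'a \<Rightarrow> (('x, 'a, 'u) domain_sum \<Rightarrow>\<^sub>C\<^sub>L ('x, 'a, 'u) domain_sum)"
  where "\<And>i j. r i j \<in> C_alg" "\<And>i j. adj (r i j) = r j i"
    and "\<And>x a x' a'. e_gen x x' a a' = (\<Sum>k\<in>UNIV. adj (r k (x, a)) o\<^sub>C r k (x', a'))"
proof -
  define entry :: "(('x \<times> 'a, ('x, 'a, 'u) domain_sum) hilbert_sum \<Rightarrow>\<^sub>C\<^sub>L ('x \<times> 'a, ('x, 'a, 'u) domain_sum) hilbert_sum) \<Rightarrow> _"
    where "entry S i j = adj (single i) o\<^sub>C S o\<^sub>C single j" for S i j
  have entry_compose: "entry (S o\<^sub>C S') i j = (\<Sum>k\<in>UNIV. entry S i k o\<^sub>C entry S' k j)" for S S' i j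
  proof (rule cblinfun_eqI)
    fix f
    have "S *\<^sub>V S' *\<^sub>V single j *\<^sub>V f = S *\<^sub>V (\<Sum>k\<in>UNIV. single k *\<^sub>V component (S' *\<^sub>V single j *\<^sub>V f) k)"
      by (simp add: sum_single_component)
    then show "entry (S o\<^sub>C S') i j *\<^sub>V f = (\<Sum>k\<in>UNIV. entry S i k o\<^sub>C entry S' k j) *\<^sub>V f"
      by (simp add: entry_def adj_single cblinfun_apply_sum component_sum)
  qed
  define V :: "('x \<times> 'a, ('x, 'a, 'u) domain_sum) hilbert_sum \<Rightarrow>\<^sub>C\<^sub>L ('x, 'a, 'u) codomain_sum"
    where "V = (\<Sum>i\<in>UNIV. gen (snd i) (fst i) o\<^sub>C adj (single i))"
  have V_single: "V o\<^sub>C single i = gen (snd i) (fst i)" for i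
    by (rule cblinfun_eqI)
      (simp add: V_def adj_single component_single sum.delta sum.delta'
        if_distrib[where f = "\<lambda>v. _ *\<^sub>V v"] cong: if_cong)
  have entry_V: "entry (adj V o\<^sub>C V) (x, a) (x', a') = e_gen x x' a a'" for x a x' a'
  proof -
    have "entry (adj V o\<^sub>C V) (x, a) (x', a') = adj (V o\<^sub>C single (x, a)) o\<^sub>C (V o\<^sub>C single (x', a'))"
      by (simp add: entry_def adj_compose cblinfun_compose_assoc)
    then show ?thesis by (simp add: V_single e_gen_def)
  qed
  \<comment> \<open>The square root requires a contraction, so \<open>V\<close> is rescaled; the
    added 1 keeps \<open>c\<close> positive without a lower bound for \<open>norm V\<close>. The
    factor \<open>c\<close> in \<open>r\<close> below undoes the rescaling.\<close>
  define c where "c = norm V + 1"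
  have c: "c > 0" by (simp add: c_def add_nonneg_pos)
  define V' where "V' = complex_of_real (1 / c) *\<^sub>C V"
  have "norm V' \<le> 1" using c by (simp add: V'_def norm_scaleC_cblinfun c_def norm_divide)
  have V': "adj V' o\<^sub>C V' = complex_of_real (1 / c^2) *\<^sub>C (adj V o\<^sub>C V)"
    by (simp add: V'_def adj_scaleC scaleC_cblinfun_compose_left scaleC_cblinfun_compose_right
      scaleC_scaleC power2_eq_square)
  have entry_linear: "entry (S + S') i j = entry S i j + entry S' i j"
    "entry (s *\<^sub>C S) i j = s *\<^sub>C entry S i j" for S S' s i j
    by (simp_all add: entry_def cblinfun_compose_add_left cblinfun_compose_add_right
      scaleC_cblinfun_compose_left scaleC_cblinfun_compose_right)
  \<comment> \<open>The matrix algebra over \<open>C_alg\<close>, realized on the direct sum; it is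
    closed because every entry depends continuously on the operator.\<close>
  define M where "M = {S. \<forall>i j. entry S i j \<in> C_alg}"
  have zero: "entry 0 i j = 0" for i j
    using entry_linear(2)[of 0 0] by (simp add: complex_vector.scale_zero_left)
  have id_C: "id_op \<in> C_alg" using id_T_sys T_sys_subset_C_alg by blast
  obtain R where R: "R \<in> M" "adj R = R" "R o\<^sub>C R = adj V' o\<^sub>C V'"
  proof (rule algebraic_square_root)
    show "csubspace M"
      by (rule complex_vector.subspaceI)
        (auto simp: M_def entry_linear zero complex_vector.subspace_0[OF csubspace_C_alg]
          complex_vector.subspace_add[OF csubspace_C_alg]
          complex_vector.subspace_scale[OF csubspace_C_alg])
    show "closed M"
      unfolding closed_sequential_limits M_def
    proof (intro allI impI CollectI, elim conjE)
      fix X S i j assume X: "\<forall>n. X n \<in> {S. \<forall>i j. entry S i j \<in> C_alg}" "X \<longlonglongrightarrow> S"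
      then have "(\<lambda>n. entry (X n) i j) \<longlonglongrightarrow> entry S i j"
        unfolding entry_def by (intro tendsto_cblinfun_compose tendsto_const)
      then show "entry S i j \<in> C_alg"
        by (rule closed_sequentially[OF closed_C_alg, rotated]) (use X(1) in blast)
    qed
    show "S o\<^sub>C S' \<in> M" if "S \<in> M" "S' \<in> M" for S S'
      using that by (auto simp: M_def entry_compose
        intro!: complex_vector.subspace_sum csubspace_C_alg C_alg_compose)
    have "entry id_op i j = (if i = j then id_op else 0)" for i j
      by (rule cblinfun_eqI) (auto simp: entry_def adj_single component_single)
    then show "id_op \<in> M"
      using id_C complex_vector.subspace_0[OF csubspace_C_alg] by (auto simp: M_def)
    show "adj V' o\<^sub>C V' \<in> M"
      by (auto simp: M_def V' entry_linear entry_V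
          intro!: complex_vector.subspace_scale[OF csubspace_C_alg] e_gen_C_alg)
    show "adj (adj V' o\<^sub>C V') = adj V' o\<^sub>C V'" by (simp add: adj_compose)
    show "norm (id_op - adj V' o\<^sub>C V') \<le> 1" using \<open>norm V' \<le> 1\<close> by (rule norm_id_minus_adj_compose_le)
  qed
  define r where "r i j = complex_of_real c *\<^sub>C entry R i j" for i j
  have adj_r: "adj (r i j) = r j i" for i j
    by (simp add: r_def entry_def adj_scaleC adj_compose R(2) cblinfun_compose_assoc)
  have "e_gen x x' a a' = (\<Sum>k\<in>UNIV. adj (r k (x, a)) o\<^sub>C r k (x', a'))" for x x' a a'
  proof -
    have "(\<Sum>k\<in>UNIV. adj (r k (x, a)) o\<^sub>C r k (x', a'))
        = complex_of_real (c^2) *\<^sub>C entry (R o\<^sub>C R) (x, a) (x', a')"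
      unfolding adj_r by (simp add: r_def entry_compose scaleC_cblinfun_compose_left
        scaleC_cblinfun_compose_right scaleC_scaleC power2_eq_square complex_vector.scale_sum_right)
    also have "\<dots> = e_gen x x' a a'"
      using c by (simp add: R(3) V' entry_linear entry_V scaleC_scaleC scaleC_one)
    finally show ?thesis ..
  qed
  moreover have "r i j \<in> C_alg" for i j
    unfolding r_def
    by (rule complex_vector.subspace_scale[OF csubspace_C_alg]) (use R(1)[unfolded M_def] in blast)
  ultimately show thesis using adj_r by (intro that[of r])
qed

text \<open>The square root turns positivity of the matrix of \<open>e_gen\<close> into an algebraic
  identity within \<open>C_alg\<close>, which \<pi> preserves; the images then have Gram
  form.\<close>

lemma representation_imp_stochastic:
  fixes \<pi> :: "(('x::finite, 'a::finite, 'u) domain_sum \<Rightarrow>\<^sub>C\<^sub>L ('x, 'a, 'u) domain_sum) \<Rightarrow>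
    ('h::complex_hilbert \<Rightarrow>\<^sub>C\<^sub>L 'h)"
  assumes \<pi>: "unital_star_rep_on C_alg \<pi>"
  shows "stochastic_operator_matrix (\<lambda>x x' a a'. \<pi> (e_gen x x' a a'))"
proof -
  obtain r :: "'x \<times> 'a \<Rightarrow> 'x \<times> 'a \<Rightarrow> (('x, 'a, 'u) domain_sum \<Rightarrow>\<^sub>C\<^sub>L ('x, 'a, 'u) domain_sum)"
    where r: "\<And>i j. r i j \<in> C_alg" "\<And>i j. adj (r i j) = r j i"
      and e_gen: "\<And>x a x' a'. e_gen x x' a a' = (\<Sum>k\<in>UNIV. adj (r k (x, a)) o\<^sub>C r k (x', a'))"
    by (rule e_gen_square_root) blast
  have lin: "clinear_on C_alg \<pi>" and compose: "\<And>S T. S \<in> C_alg \<Longrightarrow> T \<in> C_alg \<Longrightarrow>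
      \<pi> (S o\<^sub>C T) = \<pi> S o\<^sub>C \<pi> T"
    and adj: "\<And>S. S \<in> C_alg \<Longrightarrow> \<pi> (adj S) = adj (\<pi> S)" and id: "\<pi> id_op = id_op"
    using \<pi> by (auto simp: unital_star_rep_on_def)
  have "\<pi> (e_gen x x' a a') = (\<Sum>k\<in>UNIV. adj (\<pi> (r k (x, a))) o\<^sub>C \<pi> (r k (x', a')))" for x x' a a'
  proof -
    have "\<pi> (e_gen x x' a a') = (\<Sum>k\<in>UNIV. \<pi> (adj (r k (x, a)) o\<^sub>C r k (x', a')))"
      unfolding e_gen r(2)
      by (intro clinear_on_sum[OF csubspace_C_alg lin] C_alg_compose r)
    also have "\<dots> = (\<Sum>k\<in>UNIV. adj (\<pi> (r k (x, a))) o\<^sub>C \<pi> (r k (x', a')))"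
      using r by (intro sum.cong refl) (metis adj compose)
    finally show ?thesis .
  qed
  then have "(\<lambda>(x, a) (x', a'). \<pi> (e_gen x x' a a')) = (\<lambda>i j. \<Sum>k\<in>UNIV. adj (\<pi> (r k i)) o\<^sub>C \<pi> (r k j))"
    by (auto simp: fun_eq_iff)
  then have "positive_matrix UNIV (\<lambda>(x, a) (x', a'). \<pi> (e_gen x x' a a'))"
    by (simp only: positive_matrix_gram)
  then show ?thesis
    using stochastic_sum[OF csubspace_C_alg lin T_sys_subset_C_alg id]
    by (simp add: stochastic_operator_matrix_def)
qed

theorem theorem5p2:
  shows
    "(\<forall>\<phi> :: (('x::finite, 'a::finite, 'u::infinite) domain_sum \<Rightarrow>\<^sub>C\<^sub>L ('x, 'a, 'u) domain_sum) \<Rightarrow>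
            ('h::complex_hilbert \<Rightarrow>\<^sub>C\<^sub>L 'h).
        clinear_on T_sys \<phi> \<longrightarrow>
          (ucp_on T_sys \<phi> \<longleftrightarrow>
             stochastic_operator_matrix (\<lambda>x x' a a'. \<phi> (e_gen x x' a a'))) \<and>
          (stochastic_operator_matrix (\<lambda>x x' a a'. \<phi> (e_gen x x' a a')) \<longleftrightarrow>
             (\<exists>\<pi>. unital_star_rep_on C_alg \<pi> \<and> (\<forall>t\<in>T_sys. \<phi> t = \<pi> t)))) \<and>
     (\<forall>E :: 'x \<Rightarrow> 'x \<Rightarrow> 'a \<Rightarrow> 'a \<Rightarrow> ('h \<Rightarrow>\<^sub>C\<^sub>L 'h).
        stochastic_operator_matrix E \<longrightarrow>
          (\<exists>!\<phi> :: (('x, 'a, 'u) domain_sum \<Rightarrow>\<^sub>C\<^sub>L ('x, 'a, 'u) domain_sum) \<Rightarrow> ('h \<Rightarrow>\<^sub>C\<^sub>L 'h).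
             \<phi> \<in> extensional T_sys \<and> ucp_on T_sys \<phi> \<and>
             (\<forall>x x' a a'. \<phi> (e_gen x x' a a') = E x x' a a')))"
proof (intro conjI allI impI)
  fix \<phi> :: "(('x, 'a, 'u) domain_sum \<Rightarrow>\<^sub>C\<^sub>L ('x, 'a, 'u) domain_sum) \<Rightarrow> ('h \<Rightarrow>\<^sub>C\<^sub>L 'h)"
  assume \<phi>: "clinear_on T_sys \<phi>"
  show "ucp_on T_sys \<phi> \<longleftrightarrow> stochastic_operator_matrix (\<lambda>x x' a a'. \<phi> (e_gen x x' a a'))"
    using ucp_imp_stochastic stochastic_imp_ucp[OF \<phi>] by blast
  show "stochastic_operator_matrix (\<lambda>x x' a a'. \<phi> (e_gen x x' a a')) \<longleftrightarrow>
      (\<exists>\<pi>. unital_star_rep_on C_alg \<pi> \<and> (\<forall>t\<in>T_sys. \<phi> t = \<pi> t))"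
  proof
    assume "stochastic_operator_matrix (\<lambda>x x' a a'. \<phi> (e_gen x x' a a'))"
    then obtain \<pi> :: "(('x, 'a, 'u) domain_sum \<Rightarrow>\<^sub>C\<^sub>L ('x, 'a, 'u) domain_sum) \<Rightarrow> ('h \<Rightarrow>\<^sub>C\<^sub>L 'h)"
      where "unital_star_rep_on C_alg \<pi>"
        "\<And>S T. (S, T) \<in> hom_graph (\<lambda>x x' a a'. \<phi> (e_gen x x' a a')) \<Longrightarrow> \<pi> S = T"
      by (rule stochastic_representation) blast
    then show "\<exists>\<pi>. unital_star_rep_on C_alg \<pi> \<and> (\<forall>t\<in>T_sys. \<phi> t = \<pi> t)"
      using T_sys_hom_graph[OF \<phi>] by metis
  next
    assume "\<exists>\<pi>. unital_star_rep_on C_alg \<pi> \<and> (\<forall>t\<in>T_sys. \<phi> t = \<pi> t)"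
    then show "stochastic_operator_matrix (\<lambda>x x' a a'. \<phi> (e_gen x x' a a'))"
      using representation_imp_stochastic by (auto simp: e_gen_T_sys)
  qed
next
  fix E :: "'x \<Rightarrow> 'x \<Rightarrow> 'a \<Rightarrow> 'a \<Rightarrow> ('h \<Rightarrow>\<^sub>C\<^sub>L 'h)"
  assume E: "stochastic_operator_matrix E"
  obtain \<pi> :: "(('x, 'a, 'u) domain_sum \<Rightarrow>\<^sub>C\<^sub>L ('x, 'a, 'u) domain_sum) \<Rightarrow> ('h \<Rightarrow>\<^sub>C\<^sub>L 'h)"
    where \<pi>: "unital_star_rep_on C_alg \<pi>" "\<And>S T. (S, T) \<in> hom_graph E \<Longrightarrow> \<pi> S = T"
    by (rule stochastic_representation[OF E]) blast
  have "clinear_on T_sys \<pi>"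
    using \<pi>(1) T_sys_subset_C_alg unfolding unital_star_rep_on_def clinear_on_def by blast
  \<comment> \<open>The type of \<phi> also covers operators outside \<open>T_sys\<close>, where its
    values are arbitrary; restriction selects the extensional representative, for which uniqueness
    can be claimed.\<close>
  then have lin: "clinear_on T_sys (restrict \<pi> T_sys)"
    unfolding clinear_on_def
    by (simp add: complex_vector.subspace_add[OF csubspace_T_sys]
      complex_vector.subspace_scale[OF csubspace_T_sys])
  have val: "restrict \<pi> T_sys (e_gen x x' a a') = E x x' a a'" for x x' a a'
    by (simp add: e_gen_T_sys \<pi>(2)[OF hom_graph.gen])
  show "\<exists>!\<phi> :: (('x, 'a, 'u) domain_sum \<Rightarrow>\<^sub>C\<^sub>L ('x, 'a, 'u) domain_sum) \<Rightarrow> ('h \<Rightarrow>\<^sub>C\<^sub>L 'h).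
      \<phi> \<in> extensional T_sys \<and> ucp_on T_sys \<phi> \<and> (\<forall>x x' a a'. \<phi> (e_gen x x' a a') = E x x' a a')"
  proof (rule ex1I, intro conjI allI)
    show "ucp_on T_sys (restrict \<pi> T_sys)"
      by (rule stochastic_imp_ucp[OF lin]) (simp add: val E del: restrict_apply)
    show "restrict \<pi> T_sys (e_gen x x' a a') = E x x' a a'" for x x' a a' by (rule val)
    fix \<phi> :: "(('x, 'a, 'u) domain_sum \<Rightarrow>\<^sub>C\<^sub>L ('x, 'a, 'u) domain_sum) \<Rightarrow> ('h \<Rightarrow>\<^sub>C\<^sub>L 'h)"
    assume \<phi>: "\<phi> \<in> extensional T_sys \<and> ucp_on T_sys \<phi> \<and> (\<forall>x x' a a'. \<phi> (e_gen x x' a a') = E x x' a a')"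
    \<comment> \<open>The matrix of \<phi> is \<open>E\<close>, so the pair of \<open>t\<close> and
      \<open>\<phi> t\<close> lies in \<open>hom_graph E\<close>, and \<pi> takes the same value at
      \<open>t\<close>.\<close>
    have "\<phi> t = restrict \<pi> T_sys t" if "t \<in> T_sys" for t
      using T_sys_hom_graph[of \<phi> t] \<phi> \<pi>(2) that by (simp add: ucp_on_def)
    then show "\<phi> = restrict \<pi> T_sys"
      using \<phi> by (intro extensionalityI[of \<phi> T_sys]) auto
  qed simp
qed

end
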